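(* Let $X$ be a set of PA degree, and let $c:[\omega]^2\to2$ be $1$-$X$-generic for $\mathbb{P}$. Then for every $k\geq 2$ and every infinite set $Y\ll X$, every stable coloring $d:[Y]^2\to k$ has an infinite limit-homogeneous set $L\subseteq Y$ that computes no infinite homogeneous set for $c$.
   Context: $X$ has PA degree relative to $Y$, written $X\gg Y$ (equivalently $Y\ll X$), if every $Y$-computable infinite finitely-branching tree has an $X$-computable path; "$X$ has PA degree" means $X\gg\emptyset$. $\mathbb{P}$ is the forcing whose conditions are triples $p=\langle n^p,c^p,\ell^p\rangle$ with $n^p\in\omega$, $c^p:[n^p]^2\to2$, and $\ell^p:n^p\to 2\times\omega$ such that if $\ell^p(x)=\langle v,u\rangle$ then $c^p(x,y)=v$ for all $y$ with $u\le y<n^p$; $q$ extends $p$ if $n^q\ge n^p$, $c^q\supseteq c^p$, $\ell^q\supseteq\ell^p$. A coloring $c:[\omega]^2\to2$ extends $p$ (written $p\preceq c$) if $c\supseteq c^p$ and whenever $\ell^p(x)=\langle v,u\rangle$, $c(x,y)=v$ for all $y\ge u$. $c$ is $1$-$X$-generic for $\mathbb{P}$ if for every class $W$ of $\mathbb{P}$-conditions that is $\Sigma^0_1$-definable relative to $X$ there is a condition $p\preceq c$ that either belongs to $W$ or has no extension in $W$. For $d:[Y]^2\to k$ ($k=\{0,\dots,k-1\}$), $d$ is stable if $\lim_{y\in Y} d(x,y)$ exists for each $x\in Y$; $L\subseteq Y$ is limit-homogeneous for $d$ if there is $j<k$ with $\lim_y d(x,y)=j$ for all $x\in L$. $H$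 is homogeneous for $c$ if $c$ is constant on $[H]^2$. *)

theory Defs
  imports "HOL-Library.Ramsey" "HOL-Library.Nat_Bijection"
begin

section \<open>Relative computability\<close>

text \<open>
  Kleene's partial recursive functions relative to an oracle. All functions are unary; several
  arguments are packed with the Cantor pairing function \<^const>\<open>prod_encode\<close>.
\<close>

definition pfun_pair :: "(nat \<rightharpoonup> nat) \<Rightarrow> (nat \<rightharpoonup> nat) \<Rightarrow> nat \<rightharpoonup> nat" where
  "pfun_pair f g = (\<lambda>a. Option.bind (f a) (\<lambda>u. Option.bind (g a) (\<lambda>v. Some (prod_encode (u, v)))))"

text \<open>Primitive recursion: \<open>h(a, 0) = f(a)\<close> and \<open>h(a, n + 1) = g(a, n, h(a, n))\<close>.\<close>

definition pfun_prec :: "(nat \<rightharpoonup> nat) \<Rightarrow> (nat \<rightharpoonup> nat) \<Rightarrow> nat \<rightharpoonup> nat" where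
  "pfun_prec f g = (\<lambda>z. case prod_decode z of (a, m) \<Rightarrow>
     rec_nat (f a) (\<lambda>n r. Option.bind r (\<lambda>v. g (prod_encode (a, prod_encode (n, v))))) m)"

text \<open>
  Unbounded search. As usual, \<open>f(a, m)\<close> must be defined for every \<open>m\<close> below the zero that is found,
  so the condition below singles out at most one \<open>n\<close>.
\<close>

definition first_zero :: "(nat \<rightharpoonup> nat) \<Rightarrow> nat \<Rightarrow> nat \<Rightarrow> bool" where
  "first_zero f a n \<longleftrightarrow>
     f (prod_encode (a, n)) = Some 0 \<and> (\<forall>m<n. \<exists>v. f (prod_encode (a, m)) = Some (Suc v))"

definition pfun_mu :: "(nat \<rightharpoonup> nat) \<Rightarrow> nat \<rightharpoonup> nat" where
  "pfun_mu f = (\<lambda>a. if \<exists>n. first_zero f a n then Some (THE n. first_zero f a n) else None)"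

inductive partrec_in :: "nat set \<Rightarrow> (nat \<rightharpoonup> nat) \<Rightarrow> bool" for X :: "nat set" where
  zero: "partrec_in X (\<lambda>_. Some 0)"
| suc: "partrec_in X (\<lambda>n. Some (Suc n))"
| left: "partrec_in X (\<lambda>n. Some (fst (prod_decode n)))"
| right: "partrec_in X (\<lambda>n. Some (snd (prod_decode n)))"
| query: "partrec_in X (\<lambda>n. Some (if n \<in> X then 1 else 0))"
| pair: "partrec_in X f \<Longrightarrow> partrec_in X g \<Longrightarrow> partrec_in X (pfun_pair f g)"
| comp: "partrec_in X f \<Longrightarrow> partrec_in X g \<Longrightarrow> partrec_in X (f \<circ>\<^sub>m g)"
| prec: "partrec_in X f \<Longrightarrow> partrec_in X g \<Longrightarrow> partrec_in X (pfun_prec f g)"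
| mu: "partrec_in X f \<Longrightarrow> partrec_in X (pfun_mu f)"

definition fun_computable_in :: "nat set \<Rightarrow> (nat \<Rightarrow> nat) \<Rightarrow> bool" where
  "fun_computable_in X f \<longleftrightarrow> partrec_in X (\<lambda>n. Some (f n))"

definition computes :: "nat set \<Rightarrow> nat set \<Rightarrow> bool" where
  "computes X A \<longleftrightarrow> fun_computable_in X (\<lambda>n. if n \<in> A then 1 else 0)"

definition sigma1_in :: "nat set \<Rightarrow> nat set \<Rightarrow> bool" where
  "sigma1_in X W \<longleftrightarrow> (\<exists>R. computes X R \<and> W = {x. \<exists>y. prod_encode (x, y) \<in> R})"

section \<open>PA degrees\<close>

definition tree :: "nat list set \<Rightarrow> bool" where
  "tree T \<longleftrightarrow> (\<forall>\<sigma> \<tau>. \<sigma> @ \<tau> \<in> T \<longrightarrow> \<sigma> \<in> T)"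

text \<open>
  A \<open>Y\<close>-computable finitely branching tree is given together with its finite branching, by a
  \<open>Y\<close>-computable bound \<open>b\<close> on the immediate successors of each node. Allowing trees that are merely
  finitely branching, with no computable bound, would give the PA degrees relative to the jump
  of \<open>Y\<close> instead of those relative to \<open>Y\<close>.
\<close>

definition computable_fb_tree_in :: "nat set \<Rightarrow> nat list set \<Rightarrow> bool" where
  "computable_fb_tree_in Y T \<longleftrightarrow> tree T \<and> computes Y (list_encode ` T) \<and>
     (\<exists>b. fun_computable_in Y b \<and> (\<forall>\<sigma> i. \<sigma> @ [i] \<in> T \<longrightarrow> i \<le> b (list_encode \<sigma>)))"

definition is_path :: "nat list set \<Rightarrow> (nat \<Rightarrow> nat) \<Rightarrow> bool" where
  "is_path T f \<longleftrightarrow> (\<forall>n. map f [0..<n] \<in> T)"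

definition PA_over :: "nat set \<Rightarrow> nat set \<Rightarrow> bool" (infix \<open>\<ggreater>\<close> 50) where
  "X \<ggreater> Y \<longleftrightarrow>
     (\<forall>T. computable_fb_tree_in Y T \<and> infinite T \<longrightarrow> (\<exists>f. fun_computable_in X f \<and> is_path T f))"

section \<open>The forcing notion\<close>

text \<open>
  Colorings of \<open>[A]\<^sup>2\<close> are functions on the two-element subsets of \<open>A\<close>. Where a pair is
  written \<open>(x, y)\<close> in the literature, \<open>x < y\<close> is understood, so a lock on \<open>x\<close> only constrains the
  colors of \<open>{x, y}\<close> with \<open>x < y\<close>.
\<close>

record cond =
  height :: nat
  col :: "nat set \<rightharpoonup> nat"
  lock :: "nat \<rightharpoonup> nat \<times> nat"

definition conds :: "cond set" where
  "conds = {p.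
     dom (col p) = [{..<height p}]\<^bsup>2\<^esup> \<and> ran (col p) \<subseteq> {..<2} \<and>
     dom (lock p) = {..<height p} \<and> ran (lock p) \<subseteq> {..<2} \<times> UNIV \<and>
     (\<forall>x v u. lock p x = Some (v, u) \<longrightarrow>
        (\<forall>y. x < y \<and> u \<le> y \<and> y < height p \<longrightarrow> col p {x, y} = Some v))}"

definition extends :: "cond \<Rightarrow> cond \<Rightarrow> bool" where
  "extends q p \<longleftrightarrow> height p \<le> height q \<and> col p \<subseteq>\<^sub>m col q \<and> lock p \<subseteq>\<^sub>m lock q"

definition coloring_extends :: "(nat set \<Rightarrow> nat) \<Rightarrow> cond \<Rightarrow> bool" where
  "coloring_extends c p \<longleftrightarrow> col p \<subseteq>\<^sub>m (\<lambda>e. Some (c e)) \<and>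
     (\<forall>x v u. lock p x = Some (v, u) \<longrightarrow> (\<forall>y. x < y \<and> u \<le> y \<longrightarrow> c {x, y} = v))"

text \<open>
  Conditions are finite objects, coded by the canonical indices \<^const>\<open>set_encode\<close> of the (finite)
  graphs of their components.
\<close>

definition cond_code :: "cond \<Rightarrow> nat" where
  "cond_code p = prod_encode (height p, prod_encode (
     set_encode ((\<lambda>(e, v). prod_encode (set_encode e, v)) ` Map.graph (col p)),
     set_encode ((\<lambda>(x, v, u). prod_encode (x, prod_encode (v, u))) ` Map.graph (lock p))))"

lemma inj_on_cond_code: "inj_on cond_code conds"
proof (rule inj_onI)
  fix p q assume p: "p \<in> conds" and q: "q \<in> conds" and eq: "cond_code p = cond_code q"
  let ?f = "\<lambda>(e, v). prod_encode (set_encode e, v)"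
  let ?g = "\<lambda>(x, v, u). prod_encode (x, prod_encode (v, u))"
  have fin: "finite (Map.graph (col r))" "finite (Map.graph (lock r))"
    "\<And>e v. (e, v) \<in> Map.graph (col r) \<Longrightarrow> finite e" if "r \<in> conds" for r
  proof -
    have dom: "dom (col r) = [{..<height r}]\<^bsup>2\<^esup>" "dom (lock r) = {..<height r}"
      using that by (auto simp: conds_def)
    then show "finite (Map.graph (col r))" "finite (Map.graph (lock r))"
      by (simp_all add: finite_graph_iff_finite_dom finite_imp_finite_nsets)
    fix e v assume "(e, v) \<in> Map.graph (col r)"
    then have "e \<in> dom (col r)" by (auto dest: in_graphD)
    then show "finite e" by (simp add: dom nsets_def)
  qed
  have "?f ` Map.graph (col p) = ?f ` Map.graph (col q)"
    "?g ` Map.graph (lock p) = ?g ` Map.graph (lock q)" "height p = height q"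
    using eq fin[OF p] fin[OF q] by (auto simp: cond_code_def set_encode_eq)
  moreover have "inj_on ?f (Map.graph (col p) \<union> Map.graph (col q))"
    using fin(3)[OF p] fin(3)[OF q] by (auto simp: inj_on_def set_encode_eq)
  moreover have "inj ?g"
    by (auto simp: inj_def)
  ultimately have "Map.graph (col p) = Map.graph (col q)" "Map.graph (lock p) = Map.graph (lock q)"
    "height p = height q"
    by (auto simp: inj_on_Un_image_eq_iff inj_image_eq_iff)
  then have "col p = col q" "lock p = lock q" "height p = height q"
    by (metis graph_map_of_if_distinct_dom in_graphI in_graphD not_None_eq ext)+
  then show "p = q" by simp
qed

definition one_generic :: "nat set \<Rightarrow> (nat set \<Rightarrow> nat) \<Rightarrow> bool" where
  "one_generic X c \<longleftrightarrow> (\<forall>W. W \<subseteq> conds \<and> sigma1_in X (cond_code ` W) \<longrightarrow>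
     (\<exists>p\<in>conds. coloring_extends c p \<and> (p \<in> W \<or> \<not> (\<exists>q\<in>W. extends q p))))"

section \<open>Stable colorings and homogeneous sets\<close>

definition lim_color :: "(nat set \<Rightarrow> nat) \<Rightarrow> nat set \<Rightarrow> nat \<Rightarrow> nat \<Rightarrow> bool" where
  "lim_color d Y x j \<longleftrightarrow> (\<exists>m. \<forall>y\<in>Y. m < y \<longrightarrow> d {x, y} = j)"

definition stable_on :: "(nat set \<Rightarrow> nat) \<Rightarrow> nat set \<Rightarrow> bool" where
  "stable_on d Y \<longleftrightarrow> (\<forall>x\<in>Y. \<exists>j. lim_color d Y x j)"

definition limit_homogeneous :: "(nat set \<Rightarrow> nat) \<Rightarrow> nat set \<Rightarrow> nat \<Rightarrow> nat set \<Rightarrow> bool" where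
  "limit_homogeneous d Y k L \<longleftrightarrow> L \<subseteq> Y \<and> (\<exists>j<k. \<forall>x\<in>L. lim_color d Y x j)"

definition homogeneous :: "(nat set \<Rightarrow> nat) \<Rightarrow> nat set \<Rightarrow> bool" where
  "homogeneous c H \<longleftrightarrow> (\<exists>j. \<forall>e\<in>[H]\<^bsup>2\<^esup>. c e = j)"

end

theory Submission
  imports Defs
begin

text \<open>
  Let \<open>A h\<close> be the set of points of \<open>Y\<close> with limit color \<open>h\<close>. Finite sets \<open>F h \<subseteq> A h\<close> are extended
  inside a common infinite reservoir \<open>Z\<close> so as to meet, for every assignment of indices \<open>\<epsilon>\<close>, the
  disjunction over \<open>h\<close> of: the \<open>\<epsilon> h\<close>-th functional with oracle \<open>L h = \<Union>F h\<close> yields no infinite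
  homogeneous set. Consider the conditions \<open>q\<close> such that every partition of \<open>Z\<close> into parts \<open>C h\<close> has
  some \<open>E\<close> with \<open>F h \<subseteq> E \<subseteq> F h \<union> C h\<close> for which the functional outputs \<open>x < y\<close> whose color in \<open>q\<close>
  differs from the lock of \<open>q\<close> on \<open>x\<close>. If \<open>c\<close> meets this class, the partition given by the sets
  \<open>A h\<close> provides an \<open>E\<close> that can be committed to: \<open>x\<close> and \<open>y\<close> lie in no infinite homogeneous set.
  Otherwise some \<open>p \<preceq> c\<close> has no extension in the class. Extending \<open>p\<close> by color \<open>1\<close> on all new pairs and
  lock \<open>0\<close> on all new points yields, by compactness, a partition of \<open>Z\<close> whose parts allow at most one
  output above the height of \<open>p\<close>; one of its infinite parts becomes the next reservoir.

  The reservoirs must remain \<open>X\<close>-computable. Since the partitions are defined uniformly in the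
  indices, all possible reservoirs can be taken to be coded by the columns of a single member of a
  \<open>Y\<close>-computable closed class, and \<open>X \<ggreater> Y\<close> makes such a member computable in \<open>X\<close>.
\<close>

section \<open>Recursive functions and predicates\<close>

abbreviation cpair :: "nat \<Rightarrow> nat \<Rightarrow> nat" ("\<langle>_,/ _\<rangle>") where
  "\<langle>a, b\<rangle> \<equiv> prod_encode (a, b)"

abbreviation cfst :: "nat \<Rightarrow> nat" where "cfst n \<equiv> fst (prod_decode n)"
abbreviation csnd :: "nat \<Rightarrow> nat" where "csnd n \<equiv> snd (prod_decode n)"

definition decidable_in :: "nat set \<Rightarrow> (nat \<Rightarrow> bool) \<Rightarrow> bool" where
  "decidable_in X P \<longleftrightarrow> fun_computable_in X (\<lambda>n. if P n then 1 else 0)"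

lemma computes_iff: "computes X A \<longleftrightarrow> decidable_in X (\<lambda>n. n \<in> A)"
  by (simp add: computes_def decidable_in_def)

named_theorems recursive_intros

lemma fun_computable_cong:
  assumes "fun_computable_in X f" "\<And>x. f x = g x"
  shows "fun_computable_in X g"
proof -
  have "f = g" using assms(2) by (rule ext)
  with assms(1) show ?thesis by simp
qed

lemma fun_computable_comp:
  assumes "fun_computable_in X f" "fun_computable_in X g"
  shows "fun_computable_in X (\<lambda>x. f (g x))"
  using partrec_in.comp[OF assms[unfolded fun_computable_in_def]]
  by (simp add: fun_computable_in_def map_comp_def)

lemma fun_computable_pair [recursive_intros]:
  assumes "fun_computable_in X f" "fun_computable_in X g"
  shows "fun_computable_in X (\<lambda>x. \<langle>f x, g x\<rangle>)"
  using partrec_in.pair[OF assms[unfolded fun_computable_in_def]]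
  by (simp add: fun_computable_in_def pfun_pair_def)

lemma fun_computable_Suc [recursive_intros]:
  "fun_computable_in X f \<Longrightarrow> fun_computable_in X (\<lambda>x. Suc (f x))"
  by (rule fun_computable_comp[of X Suc]) (simp_all add: fun_computable_in_def partrec_in.suc)

lemma fun_computable_cfst [recursive_intros]:
  "fun_computable_in X f \<Longrightarrow> fun_computable_in X (\<lambda>x. cfst (f x))"
  by (rule fun_computable_comp[of X cfst]) (simp_all add: fun_computable_in_def partrec_in.left)

lemma fun_computable_csnd [recursive_intros]:
  "fun_computable_in X f \<Longrightarrow> fun_computable_in X (\<lambda>x. csnd (f x))"
  by (rule fun_computable_comp[of X csnd]) (simp_all add: fun_computable_in_def partrec_in.right)

lemma fun_computable_id [recursive_intros]: "fun_computable_in X (\<lambda>x. x)"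
  using fun_computable_pair[of X cfst csnd]
  by (simp add: fun_computable_in_def partrec_in.left partrec_in.right)

lemma fun_computable_const [recursive_intros]: "fun_computable_in X (\<lambda>x. c)"
proof (induction c)
  case 0
  show ?case by (simp add: fun_computable_in_def partrec_in.zero)
next
  case (Suc c)
  then show ?case by (rule fun_computable_Suc)
qed

text \<open>The whole input \<open>x\<close> serves as the parameter: \<open>pfun_prec\<close> is
  run on \<open>\<langle>x, b x\<rangle>\<close>. Most closure properties below are reduced to this
  one by writing the function with \<open>rec_nat\<close>.\<close>

lemma fun_computable_rec [recursive_intros]:
  assumes f: "fun_computable_in X f" and b: "fun_computable_in X b"
    and g: "fun_computable_in X (\<lambda>z. g (cfst z) (cfst (csnd z)) (csnd (csnd z)))"
  shows "fun_computable_in X (\<lambda>x. rec_nat (f x) (g x) (b x))"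
proof -
  let ?f = "\<lambda>n. Some (f n)" and ?g = "\<lambda>z. Some (g (cfst z) (cfst (csnd z)) (csnd (csnd z)))"
  have *: "pfun_prec ?f ?g \<langle>a, m\<rangle> = Some (rec_nat (f a) (g a) m)" for a m
    by (induction m) (simp_all add: pfun_prec_def)
  have "pfun_prec ?f ?g z = Some (rec_nat (f (cfst z)) (g (cfst z)) (csnd z))" for z
    using *[of "cfst z" "csnd z"] by simp
  then have "pfun_prec ?f ?g = (\<lambda>z. Some (rec_nat (f (cfst z)) (g (cfst z)) (csnd z)))"
    by (rule ext)
  moreover have "partrec_in X (pfun_prec ?f ?g)"
    using f g by (intro partrec_in.prec) (simp_all add: fun_computable_in_def)
  ultimately have "fun_computable_in X (\<lambda>z. rec_nat (f (cfst z)) (g (cfst z)) (csnd z))"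
    by (simp add: fun_computable_in_def)
  moreover have "fun_computable_in X (\<lambda>x. \<langle>x, b x\<rangle>)"
    by (intro fun_computable_pair fun_computable_id b)
  ultimately have "fun_computable_in X (\<lambda>x. rec_nat (f (cfst \<langle>x, b x\<rangle>)) (g (cfst \<langle>x, b x\<rangle>)) (csnd \<langle>x, b x\<rangle>))"
    by (rule fun_computable_comp)
  then show ?thesis by simp
qed

lemma fun_computable_if [recursive_intros]:
  assumes "decidable_in X P" "fun_computable_in X f" "fun_computable_in X g"
  shows "fun_computable_in X (\<lambda>x. if P x then f x else g x)"
proof -
  \<comment> \<open>A case distinction is a recursion of length 0 or 1.\<close>
  have "fun_computable_in X (\<lambda>x. rec_nat (g x) (\<lambda>_ _. f x) (if P x then 1 else 0))"
    using assms fun_computable_comp[OF assms(2) fun_computable_cfst[OF fun_computable_id]]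
    by (intro fun_computable_rec) (simp_all add: decidable_in_def)
  then show ?thesis by (rule fun_computable_cong) simp
qed

lemma decidable_comp:
  assumes "decidable_in X P" "fun_computable_in X f"
  shows "decidable_in X (\<lambda>x. P (f x))"
  using fun_computable_comp[OF assms[unfolded decidable_in_def]] by (simp add: decidable_in_def)

lemma decidable_const [recursive_intros]: "decidable_in X (\<lambda>x. c)"
  unfolding decidable_in_def by (intro recursive_intros)

lemma decidable_not [recursive_intros]:
  assumes "decidable_in X P" shows "decidable_in X (\<lambda>x. \<not> P x)"
proof -
  have "fun_computable_in X (\<lambda>x. if P x then 0 else 1)"
    by (intro recursive_intros assms)
  then show ?thesis unfolding decidable_in_def by (rule fun_computable_cong) simp
qed

lemma decidable_if [recursive_intros]:
  assumes "decidable_in X P" "decidable_in X Q" "decidable_in X R"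
  shows "decidable_in X (\<lambda>x. if P x then Q x else R x)"
proof -
  have "fun_computable_in X (\<lambda>x. if P x then (if Q x then 1 else 0) else (if R x then 1 else 0))"
    using fun_computable_if[OF assms(1) assms(2,3)[unfolded decidable_in_def]] .
  then show ?thesis unfolding decidable_in_def by (rule fun_computable_cong) simp
qed

lemma decidable_conj [recursive_intros]:
  assumes "decidable_in X P" "decidable_in X Q" shows "decidable_in X (\<lambda>x. P x \<and> Q x)"
proof -
  have "decidable_in X (\<lambda>x. if P x then Q x else False)"
    by (intro recursive_intros assms)
  then show ?thesis unfolding decidable_in_def by (rule fun_computable_cong) simp
qed

lemma decidable_disj [recursive_intros]:
  assumes "decidable_in X P" "decidable_in X Q" shows "decidable_in X (\<lambda>x. P x \<or> Q x)"
  using decidable_not[OF decidable_conj[OF decidable_not[OF assms(1)] decidable_not[OF assms(2)]]]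
  by simp

lemma decidable_imp [recursive_intros]:
  assumes "decidable_in X P" "decidable_in X Q" shows "decidable_in X (\<lambda>x. P x \<longrightarrow> Q x)"
  using decidable_disj[OF decidable_not[OF assms(1)] assms(2)] by simp

lemma decidable_iff [recursive_intros]:
  assumes "decidable_in X P" "decidable_in X Q" shows "decidable_in X (\<lambda>x. P x \<longleftrightarrow> Q x)"
proof -
  have "decidable_in X (\<lambda>x. (P x \<longrightarrow> Q x) \<and> (Q x \<longrightarrow> P x))"
    by (intro decidable_conj decidable_imp assms)
  then show ?thesis by (simp add: iff_conv_conj_imp)
qed

section \<open>Bounded quantifiers\<close>

lemma decidable_all_less [recursive_intros]:
  assumes P: "decidable_in X (\<lambda>z. P (cfst z) (csnd z))" and b: "fun_computable_in X b"
  shows "decidable_in X (\<lambda>x. \<forall>y<b x. P x y)"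
proof -
  have "rec_nat 1 (\<lambda>y r. if P x y then r else 0) n = (if \<forall>y<n. P x y then 1 else (0::nat))" for x n
    by (induction n) (auto simp: less_Suc_eq)
  moreover have "fun_computable_in X (\<lambda>x. rec_nat 1 (\<lambda>y r. if P x y then r else 0) (b x))"
  proof (intro fun_computable_rec fun_computable_const b fun_computable_if)
    show "decidable_in X (\<lambda>z. P (cfst z) (cfst (csnd z)))"
      using decidable_comp[OF P fun_computable_pair[OF fun_computable_cfst[OF fun_computable_id]
            fun_computable_cfst[OF fun_computable_csnd[OF fun_computable_id]]]]
      by simp
  qed (intro recursive_intros)
  ultimately show ?thesis by (simp add: decidable_in_def)
qed

lemma decidable_ex_less [recursive_intros]:
  assumes P: "decidable_in X (\<lambda>z. P (cfst z) (csnd z))" and b: "fun_computable_in X b"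
  shows "decidable_in X (\<lambda>x. \<exists>y<b x. P x y)"
  using decidable_not[OF decidable_all_less[where P = "\<lambda>x y. \<not> P x y", OF decidable_not[OF P] b]]
  by simp

section \<open>Arithmetic and membership in coded finite sets\<close>

lemma fun_computable_diff_1 [recursive_intros]:
  assumes "fun_computable_in X f"
  shows "fun_computable_in X (\<lambda>x. f x - 1)"
proof -
  have "rec_nat 0 (\<lambda>n r. n) m = m - 1" for m by (cases m) auto
  moreover have "fun_computable_in X (\<lambda>x. rec_nat 0 (\<lambda>n r. n) (f x))"
    by (intro recursive_intros assms)
  ultimately show ?thesis by simp
qed

lemma fun_computable_diff [recursive_intros]:
  assumes "fun_computable_in X f" "fun_computable_in X g"
  shows "fun_computable_in X (\<lambda>x. f x - g x)"
proof -
  have "rec_nat a (\<lambda>n r. r - 1) m = a - m" for a m :: nat by (induction m) auto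
  moreover have "fun_computable_in X (\<lambda>x. rec_nat (f x) (\<lambda>n r. r - 1) (g x))"
    by (intro recursive_intros assms)
  ultimately show ?thesis by simp
qed

lemma fun_computable_add [recursive_intros]:
  assumes "fun_computable_in X f" "fun_computable_in X g"
  shows "fun_computable_in X (\<lambda>x. f x + g x)"
proof -
  have "rec_nat a (\<lambda>n r. Suc r) m = a + m" for a m by (induction m) auto
  moreover have "fun_computable_in X (\<lambda>x. rec_nat (f x) (\<lambda>n r. Suc r) (g x))"
    by (intro recursive_intros assms)
  ultimately show ?thesis by simp
qed

lemma fun_computable_pow2 [recursive_intros]:
  assumes "fun_computable_in X f"
  shows "fun_computable_in X (\<lambda>x. 2 ^ f x)"
proof -
  have "rec_nat 1 (\<lambda>n r. r + r) m = (2::nat) ^ m" for m by (induction m) auto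
  moreover have "fun_computable_in X (\<lambda>x. rec_nat 1 (\<lambda>n r. r + r) (f x))"
    by (intro recursive_intros assms)
  ultimately show ?thesis by simp
qed

lemma decidable_eq_0:
  assumes "fun_computable_in X f"
  shows "decidable_in X (\<lambda>x. f x = 0)"
proof -
  have "rec_nat 1 (\<lambda>n r. 0) m = (if m = 0 then 1 else (0::nat))" for m by (cases m) auto
  moreover have "fun_computable_in X (\<lambda>x. rec_nat 1 (\<lambda>n r. 0) (f x))"
    by (intro recursive_intros assms)
  ultimately show ?thesis by (simp add: decidable_in_def)
qed

lemma decidable_le [recursive_intros]:
  assumes "fun_computable_in X f" "fun_computable_in X g"
  shows "decidable_in X (\<lambda>x. f x \<le> g x)"
  using decidable_eq_0[OF fun_computable_diff[OF assms]] by simp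

lemma decidable_less [recursive_intros]:
  assumes "fun_computable_in X f" "fun_computable_in X g"
  shows "decidable_in X (\<lambda>x. f x < g x)"
  using decidable_not[OF decidable_le[OF assms(2,1)]] by (simp add: not_le)

lemma decidable_eq [recursive_intros]:
  assumes "fun_computable_in X f" "fun_computable_in X g"
  shows "decidable_in X (\<lambda>x. f x = g x)"
  using decidable_conj[OF decidable_le[OF assms] decidable_le[OF assms(2,1)]]
  by (simp add: order_eq_iff)

lemma decidable_odd:
  assumes "fun_computable_in X f"
  shows "decidable_in X (\<lambda>x. odd (f x))"
proof -
  have "rec_nat 0 (\<lambda>n r. 1 - r) m = (if odd m then 1 else (0::nat))" for m by (induction m) simp_all
  moreover have "fun_computable_in X (\<lambda>x. rec_nat 0 (\<lambda>n r. 1 - r) (f x))"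
    by (intro recursive_intros assms)
  ultimately show ?thesis by (simp add: decidable_in_def)
qed

lemma fun_computable_half:
  assumes "fun_computable_in X f"
  shows "fun_computable_in X (\<lambda>x. f x div 2)"
proof -
  \<comment> \<open>The halves of \<open>m\<close> and \<open>m + 1\<close> sum to \<open>m\<close>,
    so halving satisfies \<open>h (Suc n) = n - h n\<close>.\<close>
  have "m - m div 2 = Suc m div 2" for m by presburger
  then have "rec_nat 0 (\<lambda>n r. n - r) m = m div (2::nat)" for m
    by (induction m) simp_all
  moreover have "fun_computable_in X (\<lambda>x. rec_nat 0 (\<lambda>n r. n - r) (f x))"
    by (intro recursive_intros assms)
  ultimately show ?thesis by simp
qed

text \<open>Bit \<open>f x\<close> of \<open>g x\<close> is found by halving \<open>g x\<close> that
  many times and testing parity.\<close>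

lemma decidable_mem_set_decode [recursive_intros]:
  assumes "fun_computable_in X f" "fun_computable_in X g"
  shows "decidable_in X (\<lambda>x. f x \<in> set_decode (g x))"
proof -
  have "rec_nat a (\<lambda>n r. r div 2) m = a div 2 ^ m" for a m :: nat
    by (induction m) (simp_all add: power_Suc2 div_mult2_eq del: power_Suc)
  moreover have "decidable_in X (\<lambda>x. odd (rec_nat (g x) (\<lambda>n r. r div 2) (f x)))"
    by (intro recursive_intros assms decidable_odd fun_computable_half)
  ultimately show ?thesis by (simp add: set_decode_def)
qed

lemma decidable_oracle: "computes X A \<Longrightarrow> fun_computable_in X f \<Longrightarrow> decidable_in X (\<lambda>x. f x \<in> A)"
  unfolding computes_iff by (rule decidable_comp)

section \<open>Computations from an oracle\<close>

text \<open>A code whose bit \<open>n\<close> is set is at least \<open>2 ^ n\<close>. The bound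
  turns quantifiers over coded finite sets into bounded ones.\<close>

lemma mem_set_decode_less: "n \<in> set_decode d \<Longrightarrow> n < d"
proof -
  assume "n \<in> set_decode d"
  then have "d div 2 ^ n \<noteq> 0"
    by (auto simp: set_decode_def intro: ccontr)
  then have "2 ^ n \<le> d"
    by (simp add: div_eq_0_iff)
  then show ?thesis
    using less_exp[of n] by linarith
qed

lemma decidable_ball_set_decode [recursive_intros]:
  assumes "decidable_in X (\<lambda>z. P (cfst z) (csnd z))" "fun_computable_in X d"
  shows "decidable_in X (\<lambda>x. \<forall>t\<in>set_decode (d x). P x t)"
proof -
  have "(\<forall>t\<in>set_decode c. P x t) \<longleftrightarrow> (\<forall>t<c. t \<in> set_decode c \<longrightarrow> P x t)" for c x
    using mem_set_decode_less by blast
  moreover have "decidable_in X (\<lambda>x. \<forall>t<d x. t \<in> set_decode (d x) \<longrightarrow> P x t)"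
    by (intro decidable_all_less decidable_imp decidable_mem_set_decode assms
        fun_computable_comp[OF assms(2)] fun_computable_cfst fun_computable_csnd fun_computable_id)
  ultimately show ?thesis by simp
qed

lemma decidable_bex_set_decode [recursive_intros]:
  assumes "decidable_in X (\<lambda>z. P (cfst z) (csnd z))" "fun_computable_in X d"
  shows "decidable_in X (\<lambda>x. \<exists>t\<in>set_decode (d x). P x t)"
  using decidable_not[OF decidable_ball_set_decode[where P = "\<lambda>x t. \<not> P x t",
        OF decidable_not[OF assms(1)] assms(2)]] by simp

lemma set_encode_mono: "finite B \<Longrightarrow> A \<subseteq> B \<Longrightarrow> set_encode A \<le> set_encode B"
  by (intro subset_decode_imp_le) (simp add: finite_subset)

lemma set_encode_less_pow2: "A \<subseteq> {..<n} \<Longrightarrow> set_encode A < 2 ^ n"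
proof -
  assume "A \<subseteq> {..<n}"
  then have "set_encode A \<le> set_encode {..<n}"
    by (intro set_encode_mono) auto
  also have "\<dots> < 2 ^ n"
    by (simp add: set_encode_def lessThan_atLeast0 sum_power2)
  finally show ?thesis .
qed

lemma cpair_mono: "a \<le> a' \<Longrightarrow> b \<le> b' \<Longrightarrow> \<langle>a, b\<rangle> \<le> \<langle>a', b'\<rangle>"
proof -
  have "mono triangle" by (rule mono_iff_le_Suc[THEN iffD2]) simp
  then show "a \<le> a' \<Longrightarrow> b \<le> b' \<Longrightarrow> ?thesis"
    by (auto simp: prod_encode_def intro!: add_mono elim: monoD)
qed

lemma cpair_strict_mono2: "b < b' \<Longrightarrow> \<langle>a, b\<rangle> < \<langle>a, b'\<rangle>"
  using cpair_mono[of a a b b'] by (simp add: order_less_le)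

lemma cpair_strict_mono1: "a < a' \<Longrightarrow> \<langle>a, b\<rangle> < \<langle>a', b\<rangle>"
  using cpair_mono[of a a' b b] by (simp add: order_less_le)

lemma less_cpair_2: "0 < a \<Longrightarrow> b < \<langle>a, b\<rangle>"
  using cpair_strict_mono1[of 0 a b] le_prod_encode_2[of b 0] by linarith

text \<open>Composite rules have positive tags, so the indices of the constituents are smaller than
  \<open>e\<close>. This drives the induction in \<open>computation_unique\<close>.\<close>

lemma csnd_less: "0 < cfst e \<Longrightarrow> csnd e < e"
  using less_cpair_2[of "cfst e" "csnd e"] by simp

lemma cfst_le: "cfst e \<le> e"
  using le_prod_encode_1[of "cfst e" "csnd e"] by simp

lemma csnd_le: "csnd e \<le> e"
  using le_prod_encode_2[of "csnd e" "cfst e"] by simp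

abbreviation derives :: "nat \<Rightarrow> nat \<Rightarrow> nat \<Rightarrow> nat \<Rightarrow> bool" where
  "derives d e x v \<equiv> \<langle>e, \<langle>x, v\<rangle>\<rangle> \<in> set_decode d"

text \<open>
  A computation is a finite set of triples \<open>\<langle>e, \<langle>x, v\<rangle>\<rangle>\<close>, each of which is justified by others. Since a
  justification only refers to smaller indices or, for primitive recursion, to a smaller recursion
  argument, circular justifications cannot occur and the triples need not be ordered. The index is
  \<open>e = \<langle>tag, arguments\<rangle>\<close> with one tag for each rule of \<^const>\<open>partrec_in\<close>.
\<close>

definition justified :: "nat set \<Rightarrow> nat \<Rightarrow> nat \<Rightarrow> nat \<Rightarrow> nat \<Rightarrow> bool" where
  "justified G d e x v \<longleftrightarrow>
     cfst e = 0 \<and> v = 0 \<or>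
     cfst e = 1 \<and> v = Suc x \<or>
     cfst e = 2 \<and> v = cfst x \<or>
     cfst e = 3 \<and> v = csnd x \<or>
     cfst e = 4 \<and> (if x \<in> G then v = 1 else v = 0) \<or>
     cfst e = 5 \<and> derives d (cfst (csnd e)) x (cfst v) \<and> derives d (csnd (csnd e)) x (csnd v) \<or>
     cfst e = 6 \<and> (\<exists>u<d. derives d (csnd (csnd e)) x u \<and> derives d (cfst (csnd e)) u v) \<or>
     cfst e = 7 \<and> (if csnd x = 0 then derives d (cfst (csnd e)) (cfst x) v
       else \<exists>u<d. derives d e \<langle>cfst x, csnd x - 1\<rangle> u \<and>
         derives d (csnd (csnd e)) \<langle>cfst x, \<langle>csnd x - 1, u\<rangle>\<rangle> v) \<or>
     cfst e = 8 \<and> derives d (csnd e) \<langle>x, v\<rangle> 0 \<and>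
       (\<forall>m<v. \<exists>w<d. derives d (csnd e) \<langle>x, m\<rangle> (Suc w))"

definition computation :: "nat set \<Rightarrow> nat \<Rightarrow> bool" where
  "computation G d \<longleftrightarrow>
     (\<forall>t<d. t \<in> set_decode d \<longrightarrow> justified G d (cfst t) (cfst (csnd t)) (csnd (csnd t)))"

text \<open>The oracle is a finite set given by its code, and all quantifiers in
  \<open>computation\<close> and \<open>justified\<close> are bounded.\<close>

lemma decidable_computation [recursive_intros]:
  assumes "fun_computable_in X g" "fun_computable_in X d"
  shows "decidable_in X (\<lambda>x. computation (set_decode (g x)) (d x))"
proof -
  have "decidable_in X (\<lambda>z. computation (set_decode (cfst z)) (csnd z))"
    unfolding computation_def justified_def by (intro recursive_intros)
  from decidable_comp[OF this fun_computable_pair[OF assms]] show ?thesis by simp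
qed

section \<open>Structural properties of computations\<close>

lemma derives_less:
  assumes "derives d e x v"
  shows "e < d" "x < d" "v < d"
  using mem_set_decode_less[OF assms] le_prod_encode_1[of e "\<langle>x, v\<rangle>"]
    le_prod_encode_2[of "\<langle>x, v\<rangle>" e] le_prod_encode_1[of x v] le_prod_encode_2[of v x]
  by linarith+

lemma computationD: "computation G d \<Longrightarrow> derives d e x v \<Longrightarrow> justified G d e x v"
  using mem_set_decode_less[of "\<langle>e, \<langle>x, v\<rangle>\<rangle>" d]
  by (auto simp: computation_def dest!: spec[of _ "\<langle>e, \<langle>x, v\<rangle>\<rangle>"])

text \<open>The set coded by \<open>d\<close> occurs only positively in \<open>justified\<close>,
  and the bounds on the quantifiers grow because inclusion of decoded sets gives
  \<open>d \<le> d'\<close>.\<close>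

lemma justified_mono:
  assumes "justified G d e x v" "set_decode d \<subseteq> set_decode d'"
  shows "justified G d' e x v"
proof -
  have "d \<le> d'" using assms(2) by (rule subset_decode_imp_le)
  then have ex: "\<exists>u<d. P u \<Longrightarrow> (\<And>u. P u \<Longrightarrow> Q u) \<Longrightarrow> \<exists>u<d'. Q u" for P Q
    by (meson order_less_le_trans)
  have sub: "t \<in> set_decode d \<Longrightarrow> t \<in> set_decode d'" for t using assms(2) by blast
  show ?thesis
    using assms(1) unfolding justified_def
    by (elim disjE) (auto split: if_splits elim!: ex intro: sub)
qed

lemma justified_cong: "(x \<in> G \<longleftrightarrow> x \<in> G') \<Longrightarrow> justified G d e x v \<longleftrightarrow> justified G' d e x v"
  by (simp add: justified_def)

lemma computationI:
  assumes "\<And>t. t \<in> set_decode d \<Longrightarrow> justified G d (cfst t) (cfst (csnd t)) (csnd (csnd t))"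
  shows "computation G d"
  using assms by (simp add: computation_def)

lemma computationD':
  "computation G d \<Longrightarrow> t \<in> set_decode d \<Longrightarrow> justified G d (cfst t) (cfst (csnd t)) (csnd (csnd t))"
  by (rule computationD) simp_all

text \<open>Use principle: a queried argument is part of a triple in the computation, so it is
  smaller than \<open>d\<close>.\<close>

lemma computation_cong:
  assumes "computation G d" "\<And>x. x < d \<Longrightarrow> x \<in> G \<longleftrightarrow> x \<in> G'"
  shows "computation G' d"
proof (rule computationI)
  fix t assume t: "t \<in> set_decode d"
  then have "cfst (csnd t) < d"
    using cfst_le[of "csnd t"] csnd_le[of t] mem_set_decode_less[OF t] by linarith
  with computationD'[OF assms(1) t] show "justified G' d (cfst t) (cfst (csnd t)) (csnd (csnd t))"
    using assms(2) justified_cong by blast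
qed

text \<open>By \<open>justified_mono\<close> triples keep their justification in a larger set; as
  they are not ordered, merging is plain union.\<close>

lemma computation_union:
  assumes "computation G d" "computation G d'"
  shows "computation G (set_encode (set_decode d \<union> set_decode d'))"
proof (rule computationI)
  let ?D = "set_encode (set_decode d \<union> set_decode d')"
  fix t assume "t \<in> set_decode ?D"
  then have "t \<in> set_decode d \<or> t \<in> set_decode d'" by simp
  then show "justified G ?D (cfst t) (cfst (csnd t)) (csnd (csnd t))"
    by (elim disjE; intro justified_mono[OF computationD'[OF assms(1)]]
        justified_mono[OF computationD'[OF assms(2)]]) simp_all
qed

lemma computation_insert:
  assumes "computation G d" "justified G d e x v"
  shows "computation G (set_encode (insert \<langle>e, \<langle>x, v\<rangle>\<rangle> (set_decode d)))"
  by (rule computationI, rule justified_mono[of G d]) (use computationD'[OF assms(1)] assms(2) in auto)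

text \<open>Outer induction on the index, inner induction on the recursion argument
  \<open>csnd x\<close>: primitive recursion also refers to its own index with a smaller recursion
  argument, all other references are to smaller indices.\<close>

lemma computation_unique:
  assumes d: "computation G d"
  shows "derives d e x v \<Longrightarrow> derives d e x v' \<Longrightarrow> v = v'"
proof (induction e arbitrary: x v v' rule: less_induct)
  case (less e)
  then show ?case
  proof (induction "csnd x" arbitrary: x v v' rule: less_induct)
    case (less x)
    have sub: "cfst (csnd e) < e" "csnd (csnd e) < e" "csnd e < e" if "0 < cfst e"
      using csnd_less[OF that] cfst_le[of "csnd e"] csnd_le[of "csnd e"] by linarith+
    note IH = less.prems(1)
    have j: "justified G d e x v" "justified G d e x v'"
      using less.prems(2,3) d by (auto intro: computationD)
    then consider "cfst e \<le> 4" | "cfst e = 5" | "cfst e = 6" | "cfst e = 7" | "cfst e = 8"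
      unfolding justified_def by linarith
    then show ?case
    proof cases
      case 1
      with j show ?thesis by (auto simp: justified_def split: if_splits)
    next
      case 2
      with j have "derives d (cfst (csnd e)) x (cfst v)" "derives d (cfst (csnd e)) x (cfst v')"
        "derives d (csnd (csnd e)) x (csnd v)" "derives d (csnd (csnd e)) x (csnd v')"
        by (auto simp: justified_def)
      with 2 have "cfst v = cfst v'" "csnd v = csnd v'"
        using IH sub by (metis zero_less_numeral)+
      then show ?thesis by (metis prod_decode_eq prod_eq_iff)
    next
      case 3
      with j obtain u u' where "derives d (csnd (csnd e)) x u" "derives d (csnd (csnd e)) x u'"
        "derives d (cfst (csnd e)) u v" "derives d (cfst (csnd e)) u' v'"
        by (auto simp: justified_def)
      with 3 show ?thesis using IH sub by (metis zero_less_numeral)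
    next
      case 4
      show ?thesis
      proof (cases "csnd x = 0")
        case True
        with 4 j have "derives d (cfst (csnd e)) (cfst x) v" "derives d (cfst (csnd e)) (cfst x) v'"
          by (auto simp: justified_def)
        with 4 show ?thesis using IH sub by (metis zero_less_numeral)
      next
        case False
        with 4 j obtain u u' where
          u: "derives d e \<langle>cfst x, csnd x - 1\<rangle> u" "derives d e \<langle>cfst x, csnd x - 1\<rangle> u'"
          and v: "derives d (csnd (csnd e)) \<langle>cfst x, \<langle>csnd x - 1, u\<rangle>\<rangle> v"
            "derives d (csnd (csnd e)) \<langle>cfst x, \<langle>csnd x - 1, u'\<rangle>\<rangle> v'"
          by (auto simp: justified_def)
        \<comment> \<open>Same index, smaller recursion argument: the inner induction hypothesis
          applies.\<close>
        have "u = u'"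
          using less.hyps[OF _ IH u] False by simp
        with 4 v show ?thesis using IH sub by (metis zero_less_numeral)
      qed
    next
      case 5
      with j have *: "derives d (csnd e) \<langle>x, v\<rangle> 0" "derives d (csnd e) \<langle>x, v'\<rangle> 0"
        "\<And>m. m < v \<Longrightarrow> \<exists>w. derives d (csnd e) \<langle>x, m\<rangle> (Suc w)"
        "\<And>m. m < v' \<Longrightarrow> \<exists>w. derives d (csnd e) \<langle>x, m\<rangle> (Suc w)"
        by (auto simp: justified_def)
      have "csnd e < e" using sub 5 by simp
      \<comment> \<open>Of two distinct search results the smaller would have to carry both the
        value 0 and a successor.\<close>
      then have "\<not> derives d (csnd e) y (Suc w)" if "derives d (csnd e) y 0" for y w
        using IH[of "csnd e" y 0 "Suc w"] that by auto
      then show ?thesis using * by (metis linorder_neqE_nat)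
    qed
  qed
qed

section \<open>Indices of partial recursive functions\<close>

lemma ex_computation_all_less:
  assumes "\<And>m. m < (n::nat) \<Longrightarrow> \<exists>d. computation G d \<and> (\<exists>v. derives d e (f m) v \<and> P m v)"
  shows "\<exists>d. computation G d \<and> (\<forall>m<n. \<exists>v. derives d e (f m) v \<and> P m v)"
  using assms
proof (induction n)
  case 0
  have "computation G 0" by (simp add: computation_def)
  then show ?case by auto
next
  case (Suc n)
  then obtain d d' v where "computation G d" "\<forall>m<n. \<exists>v. derives d e (f m) v \<and> P m v"
    "computation G d'" "derives d' e (f n) v" "P n v"
    by (metis less_Suc_eq)
  then show ?case
    by (intro exI[of _ "set_encode (set_decode d \<union> set_decode d')"])
      (auto simp: computation_union less_Suc_eq)
qed

text \<open>Only the defined values of \<open>f\<close> must be derivable; for total functions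
  \<open>computation_unique\<close> then excludes every other value.\<close>

definition computes_index :: "nat set \<Rightarrow> nat \<Rightarrow> (nat \<rightharpoonup> nat) \<Rightarrow> bool" where
  "computes_index G e f \<longleftrightarrow> (\<forall>x v. f x = Some v \<longrightarrow> (\<exists>d. computation G d \<and> derives d e x v))"

lemma computes_indexD:
  "computes_index G e f \<Longrightarrow> f x = Some v \<Longrightarrow> \<exists>d. computation G d \<and> derives d e x v"
  by (simp add: computes_index_def)

lemma ex_computation_insert:
  assumes "computation G d" "justified G d e x v"
  shows "\<exists>d. computation G d \<and> derives d e x v"
  using computation_insert[OF assms] by (intro exI conjI) auto

text \<open>\<open>0\<close> codes the empty computation, which suffices for the rules without
  premises.\<close>

lemma ex_computation_base:
  assumes "justified G 0 e x v"
  shows "\<exists>d. computation G d \<and> derives d e x v"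
  using assms by (intro ex_computation_insert[of G 0]) (auto simp: computation_def)

lemma derives_bex: "derives d e x u \<Longrightarrow> P u \<Longrightarrow> \<exists>u<d. derives d e x u \<and> P u"
  using derives_less(3) by blast

text \<open>Induction on \<open>partrec_in\<close>: the tag records the rule, computations for the
  constituents are merged, and one new triple is inserted.\<close>

lemma partrec_in_computes_index:
  assumes "partrec_in G f"
  shows "\<exists>e. computes_index G e f"
  using assms
proof induction
  case zero
  have "computes_index G \<langle>0, 0\<rangle> (\<lambda>_. Some 0)"
    by (auto simp: computes_index_def justified_def intro!: ex_computation_base)
  then show ?case ..
next
  case suc
  have "computes_index G \<langle>1, 0\<rangle> (\<lambda>n. Some (Suc n))"
    by (auto simp: computes_index_def justified_def intro!: ex_computation_base)
  then show ?case ..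
next
  case left
  have "computes_index G \<langle>2, 0\<rangle> (\<lambda>n. Some (cfst n))"
    by (auto simp: computes_index_def justified_def intro!: ex_computation_base)
  then show ?case ..
next
  case right
  have "computes_index G \<langle>3, 0\<rangle> (\<lambda>n. Some (csnd n))"
    by (auto simp: computes_index_def justified_def intro!: ex_computation_base)
  then show ?case ..
next
  case query
  have "computes_index G \<langle>4, 0\<rangle> (\<lambda>n. Some (if n \<in> G then 1 else 0))"
    by (auto simp: computes_index_def justified_def intro!: ex_computation_base)
  then show ?case ..
next
  case (pair f g)
  then obtain a b where ab: "computes_index G a f" "computes_index G b g" by blast
  have "computes_index G \<langle>5, \<langle>a, b\<rangle>\<rangle> (pfun_pair f g)"
    unfolding computes_index_def
  proof (intro allI impI)
    fix x v assume "pfun_pair f g x = Some v"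
    then obtain u w where "f x = Some u" "g x = Some w" and v: "v = \<langle>u, w\<rangle>"
      by (auto simp: pfun_pair_def bind_eq_Some_conv)
    with ab obtain d d' where d: "computation G d" "derives d a x u"
      "computation G d'" "derives d' b x w"
      by (auto simp: computes_index_def) metis
    show "\<exists>d. computation G d \<and> derives d \<langle>5, \<langle>a, b\<rangle>\<rangle> x v"
      using d v by (intro ex_computation_insert[OF computation_union[OF d(1,3)]])
        (auto simp: justified_def)
  qed
  then show ?case ..
next
  case (comp f g)
  then obtain a b where ab: "computes_index G a f" "computes_index G b g" by blast
  have "computes_index G \<langle>6, \<langle>a, b\<rangle>\<rangle> (f \<circ>\<^sub>m g)"
    unfolding computes_index_def
  proof (intro allI impI)
    fix x v assume "(f \<circ>\<^sub>m g) x = Some v"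
    then obtain u where "g x = Some u" "f u = Some v"
      by (auto simp: map_comp_def split: option.splits)
    with ab obtain d d' where d: "computation G d" "derives d a u v"
      "computation G d'" "derives d' b x u"
      by (auto simp: computes_index_def) metis
    let ?D = "set_encode (set_decode d \<union> set_decode d')"
    have "derives ?D b x u" "derives ?D a u v" using d by auto
    then have "justified G ?D \<langle>6, \<langle>a, b\<rangle>\<rangle> x v"
      using derives_bex[of b x u ?D "\<lambda>u. derives ?D a u v"] by (simp add: justified_def)
    then show "\<exists>d. computation G d \<and> derives d \<langle>6, \<langle>a, b\<rangle>\<rangle> x v"
      by (intro ex_computation_insert[OF computation_union[OF d(1,3)]])
  qed
  then show ?case ..
next
  case (prec f g)
  then obtain a b where ab: "computes_index G a f" "computes_index G b g" by blast
  let ?e = "\<langle>7, \<langle>a, b\<rangle>\<rangle>"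
  let ?r = "\<lambda>c. rec_nat (f c) (\<lambda>n r. Option.bind r (\<lambda>v. g \<langle>c, \<langle>n, v\<rangle>\<rangle>))"
  have *: "\<exists>d. computation G d \<and> derives d ?e \<langle>c, m\<rangle> v" if "?r c m = Some v" for c m v
    using that
  proof (induction m arbitrary: v)
    case 0
    then obtain d where "computation G d" "derives d a c v"
      using computes_indexD[OF ab(1)] by auto
    then show ?case by (intro ex_computation_insert[of G d]) (auto simp: justified_def)
  next
    case (Suc m)
    then obtain u where u: "?r c m = Some u" and v: "g \<langle>c, \<langle>m, u\<rangle>\<rangle> = Some v"
      by (auto simp: bind_eq_Some_conv)
    from Suc.IH[OF u] obtain d where d: "computation G d" "derives d ?e \<langle>c, m\<rangle> u" by blast
    from computes_indexD[OF ab(2) v]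
    obtain d' where d': "computation G d'" "derives d' b \<langle>c, \<langle>m, u\<rangle>\<rangle> v" by blast
    let ?D = "set_encode (set_decode d \<union> set_decode d')"
    have "derives ?D ?e \<langle>c, m\<rangle> u" "derives ?D b \<langle>c, \<langle>m, u\<rangle>\<rangle> v" using d d' by auto
    then have "justified G ?D ?e \<langle>c, Suc m\<rangle> v"
      using derives_bex[of ?e "\<langle>c, m\<rangle>" u ?D "\<lambda>u. derives ?D b \<langle>c, \<langle>m, u\<rangle>\<rangle> v"]
      by (simp add: justified_def)
    then show ?case by (intro ex_computation_insert[OF computation_union[OF d(1) d'(1)]])
  qed
  have "computes_index G ?e (pfun_prec f g)"
    unfolding computes_index_def
  proof (intro allI impI)
    fix x v assume "pfun_prec f g x = Some v"
    then show "\<exists>d. computation G d \<and> derives d ?e x v"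
      using *[of "cfst x" "csnd x" v] by (simp add: pfun_prec_def split: prod.splits)
  qed
  then show ?case ..
next
  case (mu f)
  then obtain a where a: "computes_index G a f" by blast
  have "computes_index G \<langle>8, a\<rangle> (pfun_mu f)"
    unfolding computes_index_def
  proof (intro allI impI)
    fix x v assume "pfun_mu f x = Some v"
    then have ex: "\<exists>n. first_zero f x n" and v: "v = (THE n. first_zero f x n)"
      by (auto simp: pfun_mu_def split: if_splits)
    have "n = n'" if "first_zero f x n" "first_zero f x n'" for n n'
      using that unfolding first_zero_def
      by (metis linorder_neqE_nat nat.distinct(1) option.inject)
    with ex v have "first_zero f x v" by (metis the_equality)
    then have fz: "f \<langle>x, v\<rangle> = Some 0" "\<And>m. m < v \<Longrightarrow> \<exists>w. f \<langle>x, m\<rangle> = Some (Suc w)"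
      by (auto simp: first_zero_def)
    from computes_indexD[OF a fz(1)]
    obtain d where d: "computation G d" "derives d a \<langle>x, v\<rangle> 0" by blast
    \<comment> \<open>Below the zero, finitely many computations with positive values are merged
      into one.\<close>
    have "\<exists>d. computation G d \<and> (\<exists>w. derives d a \<langle>x, m\<rangle> w \<and> w \<noteq> 0)" if "m < v" for m
      using fz(2)[OF that] computes_indexD[OF a] by (metis nat.distinct(1))
    then obtain d' where d': "computation G d'"
      "\<forall>m<v. \<exists>w. derives d' a \<langle>x, m\<rangle> w \<and> w \<noteq> 0"
      using ex_computation_all_less[of v G a "\<lambda>m. \<langle>x, m\<rangle>" "\<lambda>m w. w \<noteq> 0"] by blast
    let ?D = "set_encode (set_decode d \<union> set_decode d')"
    have "\<exists>w<?D. derives ?D a \<langle>x, m\<rangle> (Suc w)" if m: "m < v" for m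
    proof -
      from d'(2) m obtain w where "derives d' a \<langle>x, m\<rangle> (Suc w)" by (metis not0_implies_Suc)
      then have "derives ?D a \<langle>x, m\<rangle> (Suc w)" by simp
      with derives_less(3)[OF this] show ?thesis by (metis Suc_lessD)
    qed
    then have "justified G ?D \<langle>8, a\<rangle> x v" using d by (simp add: justified_def)
    then show "\<exists>d. computation G d \<and> derives d \<langle>8, a\<rangle> x v"
      by (intro ex_computation_insert[OF computation_union[OF d(1) d'(1)]])
  qed
  then show ?case ..
qed

section \<open>Members of closed classes\<close>

text \<open>The code of a nonempty list is the successor of the pair of its head and the code of its
  tail, so \<open>\<lambda>r. csnd (r - 1)\<close> takes tails; it fixes \<open>0\<close>, the code
  of the empty list.\<close>

definition code_drop :: "nat \<Rightarrow> nat \<Rightarrow> nat" where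
  "code_drop c l = rec_nat c (\<lambda>_ r. csnd (r - 1)) l"

lemma code_drop_list_encode: "code_drop (list_encode xs) l = list_encode (drop l xs)"
proof (induction l)
  case 0
  then show ?case by (simp add: code_drop_def)
next
  case (Suc l)
  have "list_encode (drop (Suc l) xs) = csnd (list_encode (drop l xs) - 1)"
  proof (cases "drop l xs")
    case Nil
    then have "drop (Suc l) xs = []" by simp
    then show ?thesis using Nil by (simp add: prod_decode_def prod_decode_aux.simps)
  next
    case (Cons y ys)
    then have "drop (Suc l) xs = ys" by (metis drop_Suc list.sel(3) tl_drop)
    then show ?thesis using Cons by simp
  qed
  with Suc show ?case by (simp add: code_drop_def)
qed

lemma code_drop_nonzero_iff: "code_drop (list_encode xs) l \<noteq> 0 \<longleftrightarrow> l < length xs"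
  by (cases "drop l xs") (auto simp: code_drop_list_encode simp flip: not_le)

lemma code_drop_nth: "l < length xs \<Longrightarrow> cfst (code_drop (list_encode xs) l - 1) = xs ! l"
  by (simp add: code_drop_list_encode flip: Cons_nth_drop_Suc)

lemma fun_computable_code_drop [recursive_intros]:
  assumes "fun_computable_in X f" "fun_computable_in X g"
  shows "fun_computable_in X (\<lambda>x. code_drop (f x) (g x))"
  unfolding code_drop_def by (intro recursive_intros assms)

lemma length_le_list_encode: "length xs \<le> list_encode xs"
proof (induction xs)
  case (Cons x xs)
  then show ?case using le_prod_encode_2[of "list_encode xs" x] by simp
qed simp

definition ones :: "nat list \<Rightarrow> nat set" where
  "ones \<sigma> = {l. l < length \<sigma> \<and> \<sigma> ! l = 1}"

lemma fun_computable_ones: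
  "fun_computable_in X (\<lambda>z. set_encode (ones (list_decode (cfst z)) \<inter> {..<csnd z}))"
proof -
  let ?b = "\<lambda>c l. code_drop c l \<noteq> 0 \<and> cfst (code_drop c l - 1) = 1"
  have "fun_computable_in X (\<lambda>z. rec_nat 0 (\<lambda>n r. if ?b (cfst z) n then 2 ^ n + r else r) (csnd z))"
    by (intro recursive_intros)
  moreover have "rec_nat 0 (\<lambda>n r. if ?b c n then 2 ^ n + r else r) m
      = set_encode (ones (list_decode c) \<inter> {..<m})" for c m
  proof (induction m)
    case (Suc m)
    have "?b c m \<longleftrightarrow> m \<in> ones (list_decode c)"
      using code_drop_nonzero_iff[of "list_decode c" m] code_drop_nth[of m "list_decode c"]
      by (auto simp: ones_def)
    then have "ones (list_decode c) \<inter> {..<Suc m} = (if ?b c m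
        then insert m (ones (list_decode c) \<inter> {..<m}) else ones (list_decode c) \<inter> {..<m})"
      by (auto simp: less_Suc_eq)
    with Suc show ?case by simp
  qed simp
  ultimately show ?thesis by simp
qed

text \<open>The 0-1 strings all of whose initial segments satisfy \<open>Q\<close> form a
  \<open>Y\<close>-computable tree with successors bounded by 1. The initial segments of
  \<open>R\<close> make it infinite, and a path is the characteristic function of the desired set.
  Thus a nonempty effectively closed class relative to \<open>Y\<close> has an
  \<open>X\<close>-computable member.\<close>

lemma PA_over_class:
  assumes PA: "X \<ggreater> Y"
    and Q: "decidable_in Y (\<lambda>z. Q (cfst z) (set_decode (csnd z)))"
    and ne: "\<And>n. Q n (R \<inter> {..<n})"
  shows "\<exists>R. computes X R \<and> (\<forall>n. Q n (R \<inter> {..<n}))"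
proof -
  define T where "T = {\<sigma>. (\<forall>l<length \<sigma>. \<sigma> ! l \<le> 1) \<and> (\<forall>n\<le>length \<sigma>. Q n (ones \<sigma> \<inter> {..<n}))}"
  have "tree T"
    unfolding tree_def
  proof (intro allI impI)
    fix \<sigma> \<tau> assume "\<sigma> @ \<tau> \<in> T"
    then have st: "\<forall>l<length (\<sigma> @ \<tau>). (\<sigma> @ \<tau>) ! l \<le> 1"
      "\<forall>n\<le>length (\<sigma> @ \<tau>). Q n (ones (\<sigma> @ \<tau>) \<inter> {..<n})"
      by (auto simp: T_def)
    have "\<sigma> ! l \<le> 1" if "l < length \<sigma>" for l
      using st(1) that by (metis length_append nth_append trans_less_add1)
    moreover have "Q n (ones \<sigma> \<inter> {..<n})" if "n \<le> length \<sigma>" for n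
    proof -
      have "ones \<sigma> \<inter> {..<n} = ones (\<sigma> @ \<tau>) \<inter> {..<n}"
        using that by (auto simp: ones_def nth_append)
      then show ?thesis using st(2) that by simp
    qed
    ultimately show "\<sigma> \<in> T" by (simp add: T_def)
  qed
  moreover have "computes Y (list_encode ` T)"
  proof -
    \<comment> \<open>A list is no longer than its code, which bounds the quantifiers;
      \<open>n = 0 \<or> code_drop c (n - 1) \<noteq> 0\<close> stands for
      \<open>n \<le> length (list_decode c)\<close>.\<close>
    have *: "c \<in> list_encode ` T \<longleftrightarrow>
        (\<forall>l<c. code_drop c l \<noteq> 0 \<longrightarrow> cfst (code_drop c l - 1) \<le> 1) \<and>
        (\<forall>n<Suc c. n = 0 \<or> code_drop c (n - 1) \<noteq> 0 \<longrightarrow>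
           Q n (set_decode (set_encode (ones (list_decode c) \<inter> {..<n}))))" (is "_ \<longleftrightarrow> ?r") for c
    proof -
      define \<sigma> where "\<sigma> = list_decode c"
      have c: "c = list_encode \<sigma>" by (simp add: \<sigma>_def)
      have len: "length \<sigma> \<le> c" unfolding c by (rule length_le_list_encode)
      have nz: "code_drop c l \<noteq> 0 \<longleftrightarrow> l < length \<sigma>" for l
        unfolding c by (rule code_drop_nonzero_iff)
      have nth: "cfst (code_drop c l - 1) = \<sigma> ! l" if "l < length \<sigma>" for l
        unfolding c by (rule code_drop_nth[OF that])
      have "c \<in> list_encode ` T \<longleftrightarrow> \<sigma> \<in> T"
        unfolding c by (metis image_iff list_encode_inverse)
      also have "\<dots> \<longleftrightarrow> ?r"
      proof -
        have "(\<forall>l<length \<sigma>. \<sigma> ! l \<le> 1) \<longleftrightarrow>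
            (\<forall>l<c. code_drop c l \<noteq> 0 \<longrightarrow> cfst (code_drop c l - 1) \<le> 1)"
          using nz nth len by (metis order_less_le_trans)
        moreover have "n = 0 \<or> code_drop c (n - 1) \<noteq> 0 \<longleftrightarrow> n \<le> length \<sigma>" for n
          using nz[of "n - 1"] by auto
        ultimately show ?thesis
          using len by (auto simp: T_def less_Suc_eq_le simp flip: \<sigma>_def)
      qed
      finally show ?thesis .
    qed
    have "decidable_in Y (\<lambda>z. Q (csnd z)
        (set_decode (set_encode (ones (list_decode (cfst z)) \<inter> {..<csnd z}))))"
      using decidable_comp[OF Q fun_computable_pair[OF
            fun_computable_csnd[OF fun_computable_id] fun_computable_ones]] by simp
    then show ?thesis
      unfolding computes_iff * by (intro recursive_intros)
  qed
  moreover have "\<exists>b. fun_computable_in Y b \<and> (\<forall>\<sigma> i. \<sigma> @ [i] \<in> T \<longrightarrow> i \<le> b (list_encode \<sigma>))"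
  proof (intro exI conjI allI impI)
    show "fun_computable_in Y (\<lambda>_. 1)" by (rule fun_computable_const)
    fix \<sigma> i assume "\<sigma> @ [i] \<in> T"
    then have "(\<sigma> @ [i]) ! length \<sigma> \<le> 1" unfolding T_def by fastforce
    then show "i \<le> 1" by simp
  qed
  moreover have "infinite T"
  proof
    assume "finite T"
    let ?s = "\<lambda>n. map (\<lambda>l. if l \<in> R then 1 else (0::nat)) [0..<n]"
    have ones: "ones (?s n) = R \<inter> {..<n}" for n by (auto simp: ones_def split: if_splits)
    have "?s n \<in> T" for n
    proof -
      have "R \<inter> {..<n} \<inter> {..<m} = R \<inter> {..<m}" if "m \<le> n" for m using that by auto
      then have "Q m (ones (?s n) \<inter> {..<m})" if "m \<le> n" for m using ne ones that by simp
      then show ?thesis by (simp add: T_def)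
    qed
    then have "range ?s \<subseteq> T" by blast
    then have "finite (range ?s)" using \<open>finite T\<close> by (rule finite_subset)
    then have "finite (length ` range ?s)" by (rule finite_imageI)
    moreover have "length ` range ?s = UNIV" by (simp add: image_image)
    ultimately show False by simp
  qed
  ultimately obtain f where f: "fun_computable_in X f" "is_path T f"
    using PA unfolding PA_over_def computable_fb_tree_in_def by blast
  have "computes X {n. f n = 1}"
    unfolding computes_iff using f(1) by (auto intro!: recursive_intros)
  moreover have "Q n ({n. f n = 1} \<inter> {..<n})" for n
  proof -
    have "map f [0..<n] \<in> T" using f(2) by (simp add: is_path_def)
    moreover have "ones (map f [0..<n]) \<inter> {..<n} = {n. f n = 1} \<inter> {..<n}"
      by (auto simp: ones_def)
    ultimately show ?thesis by (auto simp: T_def)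
  qed
  ultimately show ?thesis by blast
qed

text \<open>Koenig's lemma for binary trees, with nodes read as finite sets.\<close>

lemma finite_approximations_limit:
  fixes P :: "nat \<Rightarrow> nat set \<Rightarrow> bool"
  assumes mono: "\<And>m n C. P n C \<Longrightarrow> m \<le> n \<Longrightarrow> P m (C \<inter> {..<m})"
  shows "\<exists>C. \<forall>n. (\<exists>C'\<subseteq>{..<n}. P n C') \<longrightarrow> P n (C \<inter> {..<n})"
proof (cases "\<forall>n. \<exists>C\<subseteq>{..<n}. P n C")
  case True
  \<comment> \<open>The nodes with descendants at every level.\<close>
  define E where "E n S \<longleftrightarrow> S \<subseteq> {..<n} \<and> (\<forall>m\<ge>n. \<exists>C. P m C \<and> C \<inter> {..<n} = S)" for n S
  have "\<exists>S. E 0 S"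
    unfolding E_def using True by (intro exI[of _ "{}"]) auto
  \<comment> \<open>If both successors of \<open>S\<close> had no descendants, at levels
    \<open>m\<close> and \<open>m'\<close> respectively, an approximation above \<open>S\<close> at
    level \<open>max m m'\<close> would restrict to a descendant of one of them.\<close>
  moreover have "\<exists>S'. E (Suc n) S' \<and> S = S' \<inter> {..<n}" if S: "E n S" for S n
  proof (rule ccontr)
    assume no: "\<not> ?thesis"
    have sub: "S \<subseteq> {..<n}" using S by (simp add: E_def)
    have "\<not> E (Suc n) S" "\<not> E (Suc n) (insert n S)" using no sub by blast+
    moreover have "S \<subseteq> {..<Suc n}" "insert n S \<subseteq> {..<Suc n}" using sub by auto
    ultimately obtain m m' where m: "m \<ge> Suc n" "\<And>C. P m C \<Longrightarrow> C \<inter> {..<Suc n} \<noteq> S"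
      and m': "m' \<ge> Suc n" "\<And>C. P m' C \<Longrightarrow> C \<inter> {..<Suc n} \<noteq> insert n S"
      unfolding E_def by meson
    from S obtain C where C: "P (max m m') C" "C \<inter> {..<n} = S"
      using m(1) unfolding E_def by (metis Suc_leD max.coboundedI1)
    have "P m (C \<inter> {..<m})" "P m' (C \<inter> {..<m'})" using mono[OF C(1)] by auto
    then have "C \<inter> {..<m} \<inter> {..<Suc n} \<noteq> S" "C \<inter> {..<m'} \<inter> {..<Suc n} \<noteq> insert n S"
      using m(2) m'(2) by blast+
    moreover have "C \<inter> {..<m} \<inter> {..<Suc n} = C \<inter> {..<Suc n}" "C \<inter> {..<m'} \<inter> {..<Suc n} = C \<inter> {..<Suc n}"
      using m(1) m'(1) by auto
    moreover have "C \<inter> {..<Suc n} = S \<or> C \<inter> {..<Suc n} = insert n S"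
      using C(2) by (auto simp: less_Suc_eq)
    ultimately show False by simp
  qed
  ultimately obtain S where S: "\<And>n. E n (S n)" "\<And>n. S n = S (Suc n) \<inter> {..<n}"
    using dependent_nat_choice[of E "\<lambda>n S S'. S = S' \<inter> {..<n}"] by blast
  have S_eq: "S n = S (n + i) \<inter> {..<n}" for n i
  proof (induction i)
    case 0
    then show ?case using S(1)[of n] by (auto simp: E_def)
  next
    case (Suc i)
    have "S (n + i) = S (n + Suc i) \<inter> {..<n + i}" using S(2)[of "n + i"] by simp
    moreover have "{..<n + i} \<inter> {..<n} = {..<n}" by auto
    ultimately show ?case using Suc by (metis Int_assoc)
  qed
  have "P n ((\<Union>i. S i) \<inter> {..<n})" for n
  proof -
    have "S i \<inter> {..<n} \<subseteq> S n" for i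
    proof (cases "i \<le> n")
      case True
      then show ?thesis using S_eq[of i "n - i"] by auto
    next
      case False
      then show ?thesis using S_eq[of n "i - n"] by auto
    qed
    moreover have "S n \<subseteq> {..<n}" using S(1) by (simp add: E_def)
    ultimately have eq: "(\<Union>i. S i) \<inter> {..<n} = S n" by auto
    from S(1)[of n] obtain C where "P n C" "C \<inter> {..<n} = S n" unfolding E_def by blast
    then show ?thesis using mono[of n C n] eq by simp
  qed
  then show ?thesis by blast
next
  \<comment> \<open>The tree has finite height. A node of greatest height, if any, serves all levels
    that have approximations. Covering this case makes the result applicable without knowing whether
    the tree is infinite.\<close>
  case False
  then obtain n0 where n0: "\<not> (\<exists>C\<subseteq>{..<n0}. P n0 C)" by blast
  have bd: "n < n0" if "\<exists>C\<subseteq>{..<n}. P n C" for n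
    using that mono n0 by (metis Int_lower2 not_le)
  show ?thesis
  proof (cases "\<exists>n. \<exists>C\<subseteq>{..<n}. P n C")
    case True
    let ?n = "GREATEST n. \<exists>C\<subseteq>{..<n}. P n C"
    have "\<exists>C\<subseteq>{..<?n}. P ?n C"
      using GreatestI_ex_nat[OF True, of n0] bd by (meson less_imp_le)
    then obtain C where C: "P ?n C" by blast
    have "P n (C \<inter> {..<n})" if "\<exists>C'\<subseteq>{..<n}. P n C'" for n
      using mono[OF C] Greatest_le_nat[of "\<lambda>n. \<exists>C\<subseteq>{..<n}. P n C", OF that, of n0] bd
      by (meson less_imp_le)
    then show ?thesis by blast
  qed blast
qed

section \<open>Columns, and bounded quantifiers over finite sets\<close>

definition column :: "nat set \<Rightarrow> nat \<Rightarrow> nat set" where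
  "column R i = {z. \<langle>i, z\<rangle> \<in> R}"


text \<open>Pairing is increasing in its second argument, so the codes
  \<open>\<langle>i, z\<rangle>\<close> with \<open>z < m\<close> all lie below
  \<open>n\<close>.\<close>

lemma column_Int: "\<langle>i, m\<rangle> \<le> n \<Longrightarrow> column (R \<inter> {..<n}) i \<inter> {..<m} = column R i \<inter> {..<m}"
  using cpair_strict_mono2[of _ m i] by (fastforce simp: column_def)

lemma fun_computable_column [recursive_intros]:
  assumes "fun_computable_in X h" "fun_computable_in X i" "fun_computable_in X m"
  shows "fun_computable_in X (\<lambda>x. set_encode (column (set_decode (h x)) (i x) \<inter> {..<m x}))"
proof -
  let ?f = "\<lambda>h i m. rec_nat 0 (\<lambda>n r. if \<langle>i, n\<rangle> \<in> set_decode h then 2 ^ n + r else r) m"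
  have "fun_computable_in X (\<lambda>z. ?f (cfst z) (cfst (csnd z)) (csnd (csnd z)))"
    by (intro recursive_intros)
  from fun_computable_comp[OF this fun_computable_pair[OF assms(1) fun_computable_pair[OF assms(2,3)]]]
  have "fun_computable_in X (\<lambda>x. ?f (h x) (i x) (m x))" by simp
  moreover have "?f h i m = set_encode (column (set_decode h) i \<inter> {..<m})" for h i m
  proof (induction m)
    case (Suc m)
    have "column (set_decode h) i \<inter> {..<Suc m} = (if \<langle>i, m\<rangle> \<in> set_decode h
        then insert m (column (set_decode h) i \<inter> {..<m}) else column (set_decode h) i \<inter> {..<m})"
      by (auto simp: column_def less_Suc_eq)
    with Suc show ?case by simp
  qed simp
  ultimately show ?thesis by simp
qed

lemma set_decode_subset: "c < 2 ^ m \<Longrightarrow> set_decode c \<subseteq> {..<m}"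
proof
  fix n assume "c < 2 ^ m" "n \<in> set_decode c"
  then have "c div 2 ^ n \<noteq> 0" by (auto simp: set_decode_def intro: ccontr)
  then have "2 ^ n \<le> c" by (simp add: div_eq_0_iff)
  with \<open>c < 2 ^ m\<close> have "(2::nat) ^ n < 2 ^ m" by linarith
  then show "n \<in> {..<m}" by simp
qed

text \<open>The subsets of \<open>{..<m}\<close> are those with codes below \<open>2 ^ m\<close>,
  which makes quantifiers over them bounded number quantifiers.\<close>

lemma ex_subset_lessThan_iff: "(\<exists>C\<subseteq>{..<m}. P C) \<longleftrightarrow> (\<exists>c<2 ^ m. P (set_decode c))"
proof
  assume "\<exists>C\<subseteq>{..<m}. P C"
  then obtain C where C: "C \<subseteq> {..<m}" "P C" by blast
  then have "finite C" by (meson finite_lessThan finite_subset)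
  with C show "\<exists>c<2 ^ m. P (set_decode c)"
    by (intro exI[of _ "set_encode C"]) (simp add: set_encode_less_pow2)
qed (use set_decode_subset in blast)

lemma all_subset_lessThan_iff: "(\<forall>C\<subseteq>{..<m}. P C) \<longleftrightarrow> (\<forall>c<2 ^ m. P (set_decode c))"
  using ex_subset_lessThan_iff[of m "\<lambda>C. \<not> P C"] by blast

text \<open>
  One application of \<open>X \<ggreater> Y\<close> yields all the reservoirs of the construction at once, so that
  \<open>\<ggreater>\<close> need not be preserved from one reservoir to the next.
\<close>

lemma PA_over_columns:
  fixes G :: "nat \<Rightarrow> nat \<Rightarrow> nat set \<Rightarrow> nat set \<Rightarrow> bool"
  assumes PA: "X \<ggreater> Y" and B: "computes Y B"
    and G: "decidable_in Y (\<lambda>z. G (cfst z) (cfst (csnd z)) (set_decode (cfst (csnd (csnd z))))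
      (set_decode (csnd (csnd (csnd z)))))"
    and mono: "\<And>p n A C m. G p n A C \<Longrightarrow> m \<le> n \<Longrightarrow> G p m (A \<inter> {..<m}) (C \<inter> {..<m})"
  shows "\<exists>R. computes X R \<and> column R 0 = B \<and>
    (\<forall>i p. (\<forall>n. \<exists>C\<subseteq>{..<n}. G p n (column R i \<inter> {..<n}) C) \<longrightarrow>
      (\<forall>n. G p n (column R i \<inter> {..<n}) (column R (Suc \<langle>i, p\<rangle>) \<inter> {..<n})))"
proof -
  \<comment> \<open>Column \<open>Suc u\<close> with \<open>u = \<langle>i, p\<rangle>\<close> has
    to solve every level \<open>m\<close> that is solvable over column \<open>i\<close>. Solvability
    of one level is a finite test, so the class is effectively closed, and it is nonempty even if
    some levels are unsolvable. The guard \<open>\<langle>Suc u, m\<rangle> \<le> n\<close> ensures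
    that both columns are known up to \<open>m\<close>.\<close>
  define Q where "Q n S \<longleftrightarrow> (\<forall>z<n. \<langle>0, z\<rangle> < n \<longrightarrow> (\<langle>0, z\<rangle> \<in> S \<longleftrightarrow> z \<in> B)) \<and>
    (\<forall>u<Suc n. \<forall>m<Suc n. \<langle>Suc u, m\<rangle> \<le> n \<longrightarrow>
      (\<exists>C\<subseteq>{..<m}. G (csnd u) m (column S (cfst u) \<inter> {..<m}) C) \<longrightarrow>
      G (csnd u) m (column S (cfst u) \<inter> {..<m}) (column S (Suc u) \<inter> {..<m}))" for n S
  have G': "decidable_in Y (\<lambda>x. G (p x) (n x) (set_decode (a x)) (set_decode (c x)))"
    if "fun_computable_in Y p" "fun_computable_in Y n" "fun_computable_in Y a" "fun_computable_in Y c"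
    for p n a c
    using decidable_comp[OF G fun_computable_pair[OF that(1) fun_computable_pair[OF that(2)
        fun_computable_pair[OF that(3,4)]]]] by simp
  \<comment> \<open>\<open>G'\<close> applies to decoded sets, so the columns are rewritten as
    such.\<close>
  have coded: "column S i \<inter> {..<m} = set_decode (set_encode (column S i \<inter> {..<m}))" for S i m
    by simp
  have "decidable_in Y (\<lambda>z. Q (cfst z) (set_decode (csnd z)))"
    unfolding Q_def ex_subset_lessThan_iff
    by (subst (1 2 3) coded) (intro recursive_intros G' decidable_oracle[OF B])
  moreover have "\<exists>R. \<forall>n. Q n (R \<inter> {..<n})"
  proof -
    \<comment> \<open>The columns are chosen by well-founded recursion: column \<open>Suc u\<close>
      refers only to column \<open>cfst u\<close>, and \<open>cfst u \<le> u\<close>.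
      \<open>finite_approximations_limit\<close> supplies it whether or not all levels are
      solvable.\<close>
    define P where "P f i r \<longleftrightarrow> (case i of 0 \<Rightarrow> r = B | Suc u \<Rightarrow>
      \<forall>n. (\<exists>C\<subseteq>{..<n}. G (csnd u) n (f (cfst u) \<inter> {..<n}) C) \<longrightarrow>
        G (csnd u) n (f (cfst u) \<inter> {..<n}) (r \<inter> {..<n}))" for f :: "nat \<Rightarrow> nat set" and i r
    have "\<exists>f. \<forall>i. P f i (f i)"
    proof (rule dependent_wellorder_choice[of P])
      show "P f i r \<longleftrightarrow> P g i r" if "\<And>j. j < i \<Longrightarrow> f j = g j" for f g i r
        using that cfst_le by (auto simp: P_def less_Suc_eq_le split: nat.split)
      show "\<exists>r. P f i r" for f i
      proof (cases i)
        case (Suc u)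
        have "\<exists>r. \<forall>n. (\<exists>C\<subseteq>{..<n}. G (csnd u) n (f (cfst u) \<inter> {..<n}) C) \<longrightarrow>
            G (csnd u) n (f (cfst u) \<inter> {..<n}) (r \<inter> {..<n})"
        proof (rule finite_approximations_limit)
          fix m n :: nat and C
          assume "G (csnd u) n (f (cfst u) \<inter> {..<n}) C" "m \<le> n"
          moreover from this(2) have "f (cfst u) \<inter> {..<n} \<inter> {..<m} = f (cfst u) \<inter> {..<m}" by auto
          ultimately show "G (csnd u) m (f (cfst u) \<inter> {..<m}) (C \<inter> {..<m})"
            using mono by metis
        qed
        with Suc show ?thesis by (simp add: P_def)
      qed (simp add: P_def)
    qed
    then obtain f where f: "\<And>i. P f i (f i)" by blast
    define R where "R = {t. csnd t \<in> f (cfst t)}"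
    have col: "column R i = f i" for i by (simp add: column_def R_def)
    have "Q n (R \<inter> {..<n})" for n
      unfolding Q_def
    proof (intro conjI allI impI)
      fix z assume "\<langle>0, z\<rangle> < n"
      then show "\<langle>0, z\<rangle> \<in> R \<inter> {..<n} \<longleftrightarrow> z \<in> B"
        using f[of 0] by (simp add: R_def P_def)
    next
      fix u m assume le: "\<langle>Suc u, m\<rangle> \<le> n"
        and ex: "\<exists>C\<subseteq>{..<m}. G (csnd u) m (column (R \<inter> {..<n}) (cfst u) \<inter> {..<m}) C"
      have "\<langle>cfst u, m\<rangle> \<le> n"
        using cpair_mono[of "cfst u" "Suc u" m m] cfst_le[of u] le by linarith
      with le ex show "G (csnd u) m (column (R \<inter> {..<n}) (cfst u) \<inter> {..<m})
          (column (R \<inter> {..<n}) (Suc u) \<inter> {..<m})"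
        using f[of "Suc u"] by (simp add: column_Int col P_def)
    qed
    then show ?thesis by blast
  qed
  ultimately obtain R where R: "computes X R" "\<And>n. Q n (R \<inter> {..<n})"
    using PA_over_class[OF PA, of Q] by blast
  have "column R 0 = B"
  proof (rule set_eqI)
    fix z
    have "z \<le> \<langle>0, z\<rangle>" by (rule le_prod_encode_2)
    with R(2)[of "Suc \<langle>0, z\<rangle>"] show "z \<in> column R 0 \<longleftrightarrow> z \<in> B"
      by (simp add: Q_def column_def)
  qed
  moreover have "G p n (column R i \<inter> {..<n}) (column R (Suc \<langle>i, p\<rangle>) \<inter> {..<n})"
    if "\<forall>n. \<exists>C\<subseteq>{..<n}. G p n (column R i \<inter> {..<n}) C" for i p n
  proof -
    \<comment> \<open>\<open>?N\<close> is the least bound at which the clause of \<open>Q\<close>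
      for \<open>?u\<close> and level \<open>n\<close> is active.\<close>
    let ?u = "\<langle>i, p\<rangle>" and ?N = "\<langle>Suc \<langle>i, p\<rangle>, n\<rangle>"
    have le: "?u < Suc ?N" "n < Suc ?N"
      using le_prod_encode_1[of "Suc ?u" n] le_prod_encode_2[of n "Suc ?u"] by linarith+
    have "\<langle>i, n\<rangle> \<le> ?N" using le_prod_encode_1[of i p] by (intro cpair_mono) auto
    then have "column (R \<inter> {..<?N}) i \<inter> {..<n} = column R i \<inter> {..<n}"
      "column (R \<inter> {..<?N}) (Suc ?u) \<inter> {..<n} = column R (Suc ?u) \<inter> {..<n}"
      by (simp_all add: column_Int)
    moreover have "(\<exists>C\<subseteq>{..<n}. G (csnd ?u) n (column (R \<inter> {..<?N}) (cfst ?u) \<inter> {..<n}) C) \<longrightarrow>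
      G (csnd ?u) n (column (R \<inter> {..<?N}) (cfst ?u) \<inter> {..<n}) (column (R \<inter> {..<?N}) (Suc ?u) \<inter> {..<n})"
      using R(2)[of ?N] le unfolding Q_def by blast
    ultimately show ?thesis using that by simp
  qed
  ultimately show ?thesis using R(1) by blast
qed

section \<open>Codes of conditions\<close>

definition map_of_rel :: "('a \<times> 'b) set \<Rightarrow> 'a \<rightharpoonup> 'b" where
  "map_of_rel r a = (if \<exists>b. (a, b) \<in> r then Some (THE b. (a, b) \<in> r) else None)"

lemma map_of_rel_eq_Some_iff: "single_valued r \<Longrightarrow> map_of_rel r a = Some b \<longleftrightarrow> (a, b) \<in> r"
proof -
  assume "single_valued r"
  then have "(THE b. (a, b) \<in> r) = b" if "(a, b) \<in> r" for b
    using that by (auto simp: single_valued_def)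
  then show ?thesis by (auto simp: map_of_rel_def)
qed

text \<open>For \<open>a < b\<close> this is the canonical index of the edge
  \<open>{a, b}\<close>.\<close>

abbreviation edge_code :: "nat \<Rightarrow> nat \<Rightarrow> nat" where "edge_code a b \<equiv> 2 ^ a + 2 ^ b"

abbreviation col_code :: "nat \<Rightarrow> nat" where "col_code x \<equiv> cfst (csnd x)"
abbreviation lock_code :: "nat \<Rightarrow> nat" where "lock_code x \<equiv> csnd (csnd x)"

lemma set_encode_edge: "a < b \<Longrightarrow> set_encode {a, b} = edge_code a b"
  by simp

lemma nsets_2_eq: "[A]\<^bsup>2\<^esup> = {{a, b} |a b. a \<in> A \<and> b \<in> A \<and> a < b}" for A :: "nat set"
proof -
  have "e \<in> [A]\<^bsup>2\<^esup> \<longleftrightarrow> (\<exists>a b. e = {a, b} \<and> a \<in> A \<and> b \<in> A \<and> a < b)" for e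
    by (auto simp: nsets_def card_2_iff doubleton_eq_iff neq_iff)
  then show ?thesis by auto
qed

lemma condsD:
  assumes "p \<in> conds"
  shows "col p e = Some v \<Longrightarrow> \<exists>a b. a < b \<and> b < height p \<and> e = {a, b} \<and> v < 2"
    and "a < b \<Longrightarrow> b < height p \<Longrightarrow> \<exists>v. col p {a, b} = Some v"
    and "lock p a = Some (v, u) \<Longrightarrow> a < height p \<and> v < 2"
    and "a < height p \<Longrightarrow> \<exists>v u. lock p a = Some (v, u)"
    and "lock p a = Some (v, u) \<Longrightarrow> a < y \<Longrightarrow> u \<le> y \<Longrightarrow> y < height p \<Longrightarrow> col p {a, y} = Some v"
    and "finite (Map.graph (col p))" and "finite (Map.graph (lock p))"
proof -
  have *: "dom (col p) = [{..<height p}]\<^bsup>2\<^esup>" "ran (col p) \<subseteq> {..<2}"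
    "dom (lock p) = {..<height p}" "ran (lock p) \<subseteq> {..<2} \<times> UNIV"
    "\<forall>x v u. lock p x = Some (v, u) \<longrightarrow>
        (\<forall>y. x < y \<and> u \<le> y \<and> y < height p \<longrightarrow> col p {x, y} = Some v)"
    using assms by (simp_all add: conds_def)
  show "\<exists>a b. a < b \<and> b < height p \<and> e = {a, b} \<and> v < 2" if "col p e = Some v"
  proof -
    have "e \<in> [{..<height p}]\<^bsup>2\<^esup>" using that *(1) by blast
    moreover have "v < 2" using that *(2) by (auto simp: ran_def)
    ultimately show ?thesis by (auto simp: nsets_2_eq)
  qed
  show "\<exists>v. col p {a, b} = Some v" if "a < b" "b < height p"
  proof -
    have "{a, b} \<in> [{..<height p}]\<^bsup>2\<^esup>" using that by (auto simp: nsets_def)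
    with *(1) show ?thesis by blast
  qed
  show "a < height p \<and> v < 2" if "lock p a = Some (v, u)"
  proof -
    have "a \<in> {..<height p}" using that *(3) by blast
    moreover have "(v, u) \<in> ran (lock p)" using that by (rule ranI)
    ultimately show ?thesis using *(4) by blast
  qed
  show "\<exists>v u. lock p a = Some (v, u)" if "a < height p"
  proof -
    have "a \<in> dom (lock p)" using that *(3) by simp
    then show ?thesis by (auto simp: dom_def)
  qed
  show "col p {a, y} = Some v" if "lock p a = Some (v, u)" "a < y" "u \<le> y" "y < height p"
    using *(5) that by blast
  show "finite (Map.graph (col p))" "finite (Map.graph (lock p))"
    using *(1,3) by (simp_all add: finite_graph_iff_finite_dom finite_imp_finite_nsets)
qed

lemma cfst_cond_code [simp]: "cfst (cond_code p) = height p"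
  by (simp add: cond_code_def)

lemma col_code_iff:
  assumes "p \<in> conds"
  shows "t \<in> set_decode (col_code (cond_code p)) \<longleftrightarrow>
    (\<exists>a b v. a < b \<and> col p {a, b} = Some v \<and> t = \<langle>edge_code a b, v\<rangle>)"
proof -
  have "set_decode (col_code (cond_code p)) = (\<lambda>(e, v). \<langle>set_encode e, v\<rangle>) ` Map.graph (col p)"
    using condsD(6)[OF assms] by (simp add: cond_code_def)
  also have "t \<in> \<dots> \<longleftrightarrow> (\<exists>e v. col p e = Some v \<and> t = \<langle>set_encode e, v\<rangle>)"
    by (auto simp: Map.graph_def image_iff)
  also have "\<dots> \<longleftrightarrow> (\<exists>a b v. a < b \<and> col p {a, b} = Some v \<and> t = \<langle>edge_code a b, v\<rangle>)"
    using condsD(1)[OF assms] set_encode_edge by metis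
  finally show ?thesis .
qed

lemma lock_code_iff:
  assumes "p \<in> conds"
  shows "t \<in> set_decode (lock_code (cond_code p)) \<longleftrightarrow>
    (\<exists>a v u. lock p a = Some (v, u) \<and> t = \<langle>a, \<langle>v, u\<rangle>\<rangle>)"
proof -
  have "set_decode (lock_code (cond_code p))
      = (\<lambda>(x, v, u). \<langle>x, \<langle>v, u\<rangle>\<rangle>) ` Map.graph (lock p)"
    using condsD(7)[OF assms] by (simp add: cond_code_def)
  also have "t \<in> \<dots> \<longleftrightarrow> (\<exists>a v u. lock p a = Some (v, u) \<and> t = \<langle>a, \<langle>v, u\<rangle>\<rangle>)"
    by (auto simp: Map.graph_def image_iff)
  finally show ?thesis .
qed

lemma edge_code_eq_iff:
  assumes "a < b" "a' < b'"
  shows "edge_code a b = edge_code a' b' \<longleftrightarrow> a = a' \<and> b = b'"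
proof -
  have "edge_code a b = edge_code a' b' \<longleftrightarrow> set_encode {a, b} = set_encode {a', b'}"
    using set_encode_edge assms by metis
  also have "\<dots> \<longleftrightarrow> {a, b} = {a', b'}" by (simp add: set_encode_eq)
  also have "\<dots> \<longleftrightarrow> a = a' \<and> b = b'" using assms by (auto simp: doubleton_eq_iff)
  finally show ?thesis .
qed

lemma edge_mem_col_code_iff:
  assumes "p \<in> conds" "a < b"
  shows "\<langle>edge_code a b, v\<rangle> \<in> set_decode (col_code (cond_code p)) \<longleftrightarrow> col p {a, b} = Some v"
proof -
  have "edge_code a b = edge_code a' b' \<Longrightarrow> a' < b' \<Longrightarrow> a = a' \<and> b = b'" for a' b'
    using edge_code_eq_iff[OF assms(2)] by blast
  with assms(2) show ?thesis unfolding col_code_iff[OF assms(1)] prod_encode_eq prod.inject by blast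
qed

lemma lock_mem_lock_code_iff:
  assumes "p \<in> conds"
  shows "\<langle>a, \<langle>v, u\<rangle>\<rangle> \<in> set_decode (lock_code (cond_code p)) \<longleftrightarrow> lock p a = Some (v, u)"
  unfolding lock_code_iff[OF assms] by auto

text \<open>The image of \<open>conds\<close> under \<open>cond_code\<close>, expressed by bounded
  quantifiers and hence decidable. The third and the last clause make the coded graphs
  single-valued.\<close>

definition valid_cond_code :: "nat \<Rightarrow> bool" where
  "valid_cond_code x \<longleftrightarrow>
     (\<forall>t\<in>set_decode (col_code x). csnd t < 2 \<and> (\<exists>b<cfst x. \<exists>a<b. cfst t = edge_code a b)) \<and>
     (\<forall>b<cfst x. \<forall>a<b. \<exists>v<2. \<langle>edge_code a b, v\<rangle> \<in> set_decode (col_code x)) \<and>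
     (\<forall>t\<in>set_decode (col_code x). \<forall>t'\<in>set_decode (col_code x). cfst t = cfst t' \<longrightarrow> t = t') \<and>
     (\<forall>t\<in>set_decode (lock_code x). cfst t < cfst x \<and> cfst (csnd t) < 2 \<and>
       (\<forall>y<cfst x. cfst t < y \<and> csnd (csnd t) \<le> y \<longrightarrow>
         \<langle>edge_code (cfst t) y, cfst (csnd t)\<rangle> \<in> set_decode (col_code x))) \<and>
     (\<forall>a<cfst x. \<exists>t\<in>set_decode (lock_code x). cfst t = a) \<and>
     (\<forall>t\<in>set_decode (lock_code x). \<forall>t'\<in>set_decode (lock_code x). cfst t = cfst t' \<longrightarrow> t = t')"

lemma decidable_valid_cond_code: "decidable_in X valid_cond_code"
  unfolding valid_cond_code_def by (intro recursive_intros)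

lemma valid_cond_code_cond_code:
  assumes p: "p \<in> conds"
  shows "valid_cond_code (cond_code p)"
proof -
  let ?x = "cond_code p"
  have col: "\<exists>a b v. t = \<langle>edge_code a b, v\<rangle> \<and> a < b \<and> b < height p \<and> v < 2 \<and> col p {a, b} = Some v"
    if "t \<in> set_decode (col_code ?x)" for t
  proof -
    from that obtain a b v where "a < b" "col p {a, b} = Some v" "t = \<langle>edge_code a b, v\<rangle>"
      by (auto simp: col_code_iff[OF p])
    moreover from condsD(1)[OF p this(2)] this(1) have "b < height p" "v < 2"
      by (auto simp: doubleton_eq_iff)
    ultimately show ?thesis by blast
  qed
  have lock: "\<exists>a v u. t = \<langle>a, \<langle>v, u\<rangle>\<rangle> \<and> a < height p \<and> v < 2 \<and> lock p a = Some (v, u)"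
    if "t \<in> set_decode (lock_code ?x)" for t
    using that condsD(3)[OF p] by (auto simp: lock_code_iff[OF p])
  show ?thesis
    unfolding valid_cond_code_def cfst_cond_code
  proof (intro conjI allI impI ballI)
    fix t assume t: "t \<in> set_decode (col_code ?x)"
    from col[OF t] show "csnd t < 2" "\<exists>b<height p. \<exists>a<b. cfst t = edge_code a b"
      by auto
  next
    fix b a assume ab: "b < height p" "a < b"
    then obtain v where v: "col p {a, b} = Some v" using condsD(2)[OF p] by blast
    then have "v < 2" using condsD(1)[OF p] by blast
    with v ab show "\<exists>v<2. \<langle>edge_code a b, v\<rangle> \<in> set_decode (col_code ?x)"
      using edge_mem_col_code_iff[OF p] by blast
  next
    fix t t' assume "t \<in> set_decode (col_code ?x)" "t' \<in> set_decode (col_code ?x)" "cfst t = cfst t'"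
    then show "t = t'"
      using col[of t] col[of t'] edge_code_eq_iff by fastforce
  next
    fix t assume t: "t \<in> set_decode (lock_code ?x)"
    from lock[OF t] obtain a v u where a: "t = \<langle>a, \<langle>v, u\<rangle>\<rangle>" "a < height p" "v < 2"
      "lock p a = Some (v, u)" by blast
    then show "cfst t < height p" "cfst (csnd t) < 2" by auto
    fix y assume "y < height p" "cfst t < y \<and> csnd (csnd t) \<le> y"
    with a show "\<langle>edge_code (cfst t) y, cfst (csnd t)\<rangle> \<in> set_decode (col_code ?x)"
      using condsD(5)[OF p] edge_mem_col_code_iff[OF p] by simp
  next
    fix a assume "a < height p"
    then obtain v u where "lock p a = Some (v, u)" using condsD(4)[OF p] by blast
    then have "\<langle>a, \<langle>v, u\<rangle>\<rangle> \<in> set_decode (lock_code ?x)"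
      using lock_mem_lock_code_iff[OF p] by blast
    then show "\<exists>t\<in>set_decode (lock_code ?x). cfst t = a"
      by (intro bexI[of _ "\<langle>a, \<langle>v, u\<rangle>\<rangle>"]) simp_all
  next
    fix t t' assume "t \<in> set_decode (lock_code ?x)" "t' \<in> set_decode (lock_code ?x)" "cfst t = cfst t'"
    then show "t = t'"
      using lock[of t] lock[of t'] by fastforce
  qed
qed

text \<open>Single-valuedness allows both maps to be read back from their coded graphs.\<close>

lemma valid_cond_code_ex:
  assumes "valid_cond_code x"
  shows "\<exists>p\<in>conds. cond_code p = x"
proof -
  let ?cs = "set_decode (col_code x)" and ?ls = "set_decode (lock_code x)" and ?n = "cfst x"
  note valid = assms[unfolded valid_cond_code_def]
  have cs: "csnd t < 2 \<and> (\<exists>b<?n. \<exists>a<b. cfst t = edge_code a b)" if "t \<in> ?cs" for t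
    using valid that by (elim conjE) (erule (1) bspec)
  have cs': "\<exists>v<2. \<langle>edge_code a b, v\<rangle> \<in> ?cs" if "b < ?n" "a < b" for a b
    using valid that by simp
  have cs_unique: "t = t'" if "t \<in> ?cs" "t' \<in> ?cs" "cfst t = cfst t'" for t t'
    using valid that by simp
  have ls: "cfst t < ?n \<and> cfst (csnd t) < 2 \<and> (\<forall>y<?n. cfst t < y \<and> csnd (csnd t) \<le> y \<longrightarrow>
      \<langle>edge_code (cfst t) y, cfst (csnd t)\<rangle> \<in> ?cs)" if "t \<in> ?ls" for t
    using valid that by simp
  have ls': "\<exists>t\<in>?ls. cfst t = a" if "a < ?n" for a
    using valid that by simp
  have ls_unique: "t = t'" if "t \<in> ?ls" "t' \<in> ?ls" "cfst t = cfst t'" for t t'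
    using valid that by simp
  \<comment> \<open>\<open>finite e\<close> restricts to the sets on which \<open>set_encode\<close>
    is injective.\<close>
  define r where "r = {(e, v). finite e \<and> \<langle>set_encode e, v\<rangle> \<in> ?cs}"
  define s where "s = {(a, v, u). \<langle>a, \<langle>v, u\<rangle>\<rangle> \<in> ?ls}"
  have r: "single_valued r"
  proof (rule single_valuedI)
    fix e v v' assume "(e, v) \<in> r" "(e, v') \<in> r"
    then show "v = v'"
      using cs_unique[of "\<langle>set_encode e, v\<rangle>" "\<langle>set_encode e, v'\<rangle>"] by (simp add: r_def)
  qed
  have s: "single_valued s"
  proof (rule single_valuedI)
    fix a w w' assume "(a, w) \<in> s" "(a, w') \<in> s"
    then show "w = w'"
      using ls_unique[of "\<langle>a, \<langle>fst w, snd w\<rangle>\<rangle>" "\<langle>a, \<langle>fst w', snd w'\<rangle>\<rangle>"]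
      by (auto simp: s_def)
  qed
  have e: "\<exists>a b. a < b \<and> b < ?n \<and> e = {a, b} \<and> v < 2" if "(e, v) \<in> r" for e v
  proof -
    from that have "finite e" and m: "\<langle>set_encode e, v\<rangle> \<in> ?cs" by (auto simp: r_def)
    from cs[OF m] obtain a b where ab: "b < ?n" "a < b" "set_encode e = edge_code a b" "v < 2"
      by auto
    then have "set_encode e = set_encode {a, b}" by simp
    with \<open>finite e\<close> have "e = {a, b}" by (simp add: set_encode_eq)
    with ab show ?thesis by blast
  qed
  have e': "\<exists>v. ({a, b}, v) \<in> r" if "a < b" "b < ?n" for a b
    using cs'[OF that(2,1)] that(1) by (auto simp: r_def)
  let ?p = "\<lparr>height = ?n, col = map_of_rel r, lock = map_of_rel s\<rparr>"
  have graph: "Map.graph (map_of_rel r) = r" "Map.graph (map_of_rel s) = s"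
    by (auto simp: Map.graph_def map_of_rel_eq_Some_iff r s)
  have "?p \<in> conds"
    unfolding conds_def mem_Collect_eq cond.simps
  proof (intro conjI allI impI)
    show "dom (map_of_rel r) = [{..<?n}]\<^bsup>2\<^esup>"
    proof (intro equalityI subsetI)
      fix f assume "f \<in> dom (map_of_rel r)"
      then obtain v where "(f, v) \<in> r" by (auto simp: map_of_rel_eq_Some_iff r)
      from e[OF this] show "f \<in> [{..<?n}]\<^bsup>2\<^esup>" by (force simp: nsets_2_eq)
    next
      fix f assume "f \<in> [{..<?n}]\<^bsup>2\<^esup>"
      then obtain a b where "f = {a, b}" "a < b" "b < ?n" by (auto simp: nsets_2_eq)
      with e' show "f \<in> dom (map_of_rel r)" by (auto simp: dom_def map_of_rel_eq_Some_iff r)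
    qed
    show "ran (map_of_rel r) \<subseteq> {..<2}"
      using e by (auto simp: ran_def map_of_rel_eq_Some_iff r)
    show "dom (map_of_rel s) = {..<?n}"
    proof (intro equalityI subsetI)
      fix a assume "a \<in> dom (map_of_rel s)"
      then obtain v u where "\<langle>a, \<langle>v, u\<rangle>\<rangle> \<in> ?ls" by (auto simp: map_of_rel_eq_Some_iff s) (auto simp: s_def)
      from ls[OF this] show "a \<in> {..<?n}" by simp
    next
      fix a assume "a \<in> {..<?n}"
      then obtain t where t: "t \<in> ?ls" "cfst t = a" using ls' by auto
      from t(1) have "(cfst t, cfst (csnd t), csnd (csnd t)) \<in> s" by (simp add: s_def)
      then have "map_of_rel s a = Some (cfst (csnd t), csnd (csnd t))"
        using t(2) by (simp add: map_of_rel_eq_Some_iff s)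
      then show "a \<in> dom (map_of_rel s)" by blast
    qed
    show "ran (map_of_rel s) \<subseteq> {..<2} \<times> UNIV"
    proof
      fix w assume "w \<in> ran (map_of_rel s)"
      then obtain a where "map_of_rel s a = Some w" by (auto simp: ran_def)
      then have "\<langle>a, \<langle>fst w, snd w\<rangle>\<rangle> \<in> ?ls" by (auto simp: map_of_rel_eq_Some_iff s) (auto simp: s_def)
      from ls[OF this] show "w \<in> {..<2} \<times> UNIV" by (cases w) simp
    qed
    fix a v u y assume "map_of_rel s a = Some (v, u)" "a < y \<and> u \<le> y \<and> y < ?n"
    then show "map_of_rel r {a, y} = Some v"
      using ls[of "\<langle>a, \<langle>v, u\<rangle>\<rangle>"] by (simp add: map_of_rel_eq_Some_iff r s) (simp add: r_def s_def)
  qed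
  moreover have "cond_code ?p = x"
  proof -
    have "(\<lambda>(e, v). \<langle>set_encode e, v\<rangle>) ` r = ?cs"
    proof (intro equalityI subsetI)
      fix t assume t: "t \<in> ?cs"
      from cs[OF t] obtain a b where ab: "a < b" "cfst t = edge_code a b" by blast
      have t_eq: "t = \<langle>set_encode {a, b}, csnd t\<rangle>"
        using set_encode_edge[OF ab(1)] by (simp flip: ab(2))
      have "({a, b}, csnd t) \<in> r"
        unfolding r_def mem_Collect_eq case_prod_conv using t t_eq by simp
      then show "t \<in> (\<lambda>(e, v). \<langle>set_encode e, v\<rangle>) ` r"
        by (rule rev_image_eqI) (simp only: case_prod_conv flip: t_eq)
    qed (auto simp: r_def)
    moreover have "(\<lambda>(x, v, u). \<langle>x, \<langle>v, u\<rangle>\<rangle>) ` s = ?ls"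
    proof (intro equalityI subsetI)
      fix t assume t: "t \<in> ?ls"
      then have "(cfst t, cfst (csnd t), csnd (csnd t)) \<in> s" by (simp add: s_def)
      then show "t \<in> (\<lambda>(x, v, u). \<langle>x, \<langle>v, u\<rangle>\<rangle>) ` s"
        by (rule rev_image_eqI) simp
    qed (auto simp: s_def)
    ultimately show ?thesis by (simp add: cond_code_def graph)
  qed
  ultimately show ?thesis by (intro bexI[of _ ?p])
qed

text \<open>Adding \<open>valid_cond_code\<close> to the decidable matrix keeps numbers that code no
  condition out of the class.\<close>

lemma sigma1_in_cond_code:
  assumes "decidable_in X (\<lambda>z. S (cfst z) (csnd z))"
  shows "sigma1_in X (cond_code ` {p \<in> conds. \<exists>m. S (cond_code p) m})"
  unfolding sigma1_in_def
proof (intro exI conjI)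
  let ?R = "{z. valid_cond_code (cfst z) \<and> S (cfst z) (csnd z)}"
  show "computes X ?R"
    unfolding computes_iff mem_Collect_eq
    by (intro recursive_intros assms decidable_comp[OF decidable_valid_cond_code])
  show "cond_code ` {p \<in> conds. \<exists>m. S (cond_code p) m} = {x. \<exists>y. \<langle>x, y\<rangle> \<in> ?R}"
    using valid_cond_code_cond_code valid_cond_code_ex by fastforce
qed

section \<open>The forcing construction\<close>

text \<open>
  Parameters of the forcing step are coded as finite sets: \<open>a\<close> is the graph of the assignment of
  indices to the colors in play, \<open>b\<close> the set of all \<open>\<langle>h, z\<rangle>\<close> with \<open>z\<close> in the finite part for
  color \<open>h\<close>, and \<open>C\<close> the set of all \<open>\<langle>h, z\<rangle>\<close> with \<open>z\<close> in the \<open>h\<close>-th part of a partition.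
\<close>

definition splitting :: "nat \<Rightarrow> nat \<Rightarrow> nat set \<Rightarrow> nat set \<Rightarrow> nat \<Rightarrow> nat \<Rightarrow> nat \<Rightarrow> bool" where
  "splitting a b C E d x y \<longleftrightarrow> x < y \<and> computation E d \<and>
     (\<exists>t\<in>set_decode a. (\<forall>q\<in>set_decode b. cfst q = cfst t \<longrightarrow> csnd q \<in> E) \<and>
       (\<forall>z\<in>E. \<langle>cfst t, z\<rangle> \<in> set_decode b \<or> \<langle>cfst t, z\<rangle> \<in> C) \<and>
       derives d (csnd t) x 1 \<and> derives d (csnd t) y 1)"

text \<open>Covers with possible overlaps are meant. A point has to be covered only when its codes
  under all colors in play lie below \<open>n\<close>, since truncation at \<open>n\<close> could
  otherwise remove the part containing it.\<close>

definition partitions :: "nat \<Rightarrow> nat \<Rightarrow> nat \<Rightarrow> nat \<Rightarrow> nat set \<Rightarrow> nat set \<Rightarrow> bool" where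
  "partitions a j s n A C \<longleftrightarrow>
     (\<forall>z<n. (\<forall>t\<in>set_decode a. \<langle>cfst t, z\<rangle> < n) \<and> s \<le> z \<and> \<langle>j, z\<rangle> < n \<and> \<langle>j, z\<rangle> \<in> A \<longrightarrow>
       (\<exists>t\<in>set_decode a. \<langle>cfst t, z\<rangle> \<in> C)) \<and>
     (\<forall>t\<in>set_decode a. \<forall>z<n. \<langle>cfst t, z\<rangle> \<in> C \<and> \<langle>j, z\<rangle> < n \<longrightarrow> s \<le> z \<and> \<langle>j, z\<rangle> \<in> A)"

text \<open>\<open>N\<close> is later the height of a condition, so that only pairs whose smaller
  point is new are controlled. All witnesses are bounded by \<open>n\<close>, which makes each level
  a finite test.\<close>

definition nonsplitting :: "nat \<Rightarrow> nat \<Rightarrow> nat \<Rightarrow> nat \<Rightarrow> nat \<Rightarrow> nat \<Rightarrow> nat set \<Rightarrow> nat set \<Rightarrow> bool" where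
  "nonsplitting a b j s N n A C \<longleftrightarrow> partitions a j s n A C \<and>
     (\<forall>d<n. \<forall>e<n. \<forall>x<n. \<forall>y<n. N \<le> x \<longrightarrow> \<not> splitting a b C (set_decode e) d x y)"

text \<open>The five parameters are packed into one number to fit the single parameter
  \<open>p\<close> of \<open>PA_over_columns\<close>.\<close>

definition nonsplitting_class :: "nat \<Rightarrow> nat \<Rightarrow> nat set \<Rightarrow> nat set \<Rightarrow> bool" where
  "nonsplitting_class p = nonsplitting (cfst p) (cfst (csnd p)) (cfst (csnd (csnd p)))
     (cfst (csnd (csnd (csnd p)))) (csnd (csnd (csnd (csnd p))))"

lemma partitions_Int: "m \<le> n \<Longrightarrow> partitions a j s m (A \<inter> {..<n}) C \<longleftrightarrow> partitions a j s m A C"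
  unfolding partitions_def by (smt (verit) Int_iff lessThan_iff order_less_le_trans)

lemma partitions_mono:
  assumes "partitions a j s n A C" "m \<le> n"
  shows "partitions a j s m (A \<inter> {..<m}) (C \<inter> {..<m})"
  unfolding partitions_def
proof (intro conjI allI ballI impI)
  fix z assume "z < m" and z: "(\<forall>t\<in>set_decode a. \<langle>cfst t, z\<rangle> < m) \<and> s \<le> z \<and> \<langle>j, z\<rangle> < m \<and> \<langle>j, z\<rangle> \<in> A \<inter> {..<m}"
  with assms(2) have "z < n" "\<forall>t\<in>set_decode a. \<langle>cfst t, z\<rangle> < n" "\<langle>j, z\<rangle> < n" by auto
  with assms(1) z obtain t where "t \<in> set_decode a" "\<langle>cfst t, z\<rangle> \<in> C"
    unfolding partitions_def by blast
  with z show "\<exists>t\<in>set_decode a. \<langle>cfst t, z\<rangle> \<in> C \<inter> {..<m}" by blast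
next
  fix t z assume t: "t \<in> set_decode a" "z < m" "\<langle>cfst t, z\<rangle> \<in> C \<inter> {..<m} \<and> \<langle>j, z\<rangle> < m"
  with assms(2) have "z < n" "\<langle>cfst t, z\<rangle> \<in> C" "\<langle>j, z\<rangle> < n" by auto
  with assms(1) t(1) have "s \<le> z \<and> \<langle>j, z\<rangle> \<in> A" unfolding partitions_def by blast
  with t show "s \<le> z" "\<langle>j, z\<rangle> \<in> A \<inter> {..<m}" by auto
qed

lemma splitting_mono: "splitting a b C E d x y \<Longrightarrow> C \<subseteq> C' \<Longrightarrow> splitting a b C' E d x y"
  unfolding splitting_def by blast

text \<open>Shrinking \<open>C\<close> creates no splitting, and \<open>partitions\<close> survives
  truncation. This is the monotonicity that \<open>PA_over_columns\<close> demands.\<close>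

lemma nonsplitting_class_mono:
  assumes "nonsplitting_class p n A C" "m \<le> n"
  shows "nonsplitting_class p m (A \<inter> {..<m}) (C \<inter> {..<m})"
  using assms partitions_mono[OF _ assms(2)] splitting_mono[of _ _ "C \<inter> {..<m}" _ _ _ _ C]
  unfolding nonsplitting_class_def nonsplitting_def
  by (meson Int_lower1 order_less_le_trans)

lemma decidable_nonsplitting_class:
  "decidable_in X (\<lambda>z. nonsplitting_class (cfst z) (cfst (csnd z)) (set_decode (cfst (csnd (csnd z))))
      (set_decode (csnd (csnd (csnd z)))))"
  unfolding nonsplitting_class_def nonsplitting_def partitions_def splitting_def
  by (intro recursive_intros)

text \<open>Column \<open>i\<close> codes a whole partition, of which \<open>j\<close> selects one
  part; raising \<open>s\<close> discards finitely many points.\<close>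

definition reservoir :: "nat set \<Rightarrow> nat \<Rightarrow> nat \<Rightarrow> nat \<Rightarrow> nat set" where
  "reservoir R i j s = {z. s \<le> z \<and> \<langle>j, z\<rangle> \<in> column R i}"

lemma infinite_reservoir: "infinite (reservoir R i j s) \<Longrightarrow> infinite (reservoir R i j s')"
proof
  assume "infinite (reservoir R i j s)" "finite (reservoir R i j s')"
  moreover have "reservoir R i j s \<subseteq> reservoir R i j s' \<union> {..<s'}"
    by (auto simp: reservoir_def)
  ultimately show False by (meson finite_UnI finite_lessThan finite_subset)
qed

lemma reservoir_antimono: "s \<le> s' \<Longrightarrow> reservoir R i j s' \<subseteq> reservoir R i j s"
  by (auto simp: reservoir_def)

text \<open>
  The locks of the new points apply only from the height of the new condition on, so they may disagree
  with the color \<open>1\<close> of the new pairs.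
\<close>

definition clashing_extension :: "cond \<Rightarrow> nat \<Rightarrow> cond" where
  "clashing_extension p M = \<lparr>height = M,
     col = (\<lambda>e. if e \<in> [{..<M}]\<^bsup>2\<^esup> then
         if e \<in> [{..<height p}]\<^bsup>2\<^esup> then col p e
         else Some (case lock p (Min e) of Some (v, u) \<Rightarrow> v | None \<Rightarrow> 1)
       else None),
     lock = (\<lambda>x. if x < height p then lock p x else if x < M then Some (0, M) else None)\<rparr>"

text \<open>A new pair with an old smaller point takes the color of that point's lock, so the old
  locks remain obeyed. New points have no lock in \<open>p\<close>, which yields the color 1, and
  their own locks start at \<open>M\<close>, beyond all pairs of the new condition.\<close>

lemma clashing_extension:
  assumes p: "p \<in> conds" and M: "height p \<le> M"
  defines "q \<equiv> clashing_extension p M"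
  shows "q \<in> conds" "extends q p" "height q = M"
    and "height p \<le> x \<Longrightarrow> x < y \<Longrightarrow> y < M \<Longrightarrow> col q {x, y} = Some 1"
    and "height p \<le> x \<Longrightarrow> x < M \<Longrightarrow> lock q x = Some (0, M)"
proof -
  have pc: "dom (col p) = [{..<height p}]\<^bsup>2\<^esup>" "ran (col p) \<subseteq> {..<2}"
    "dom (lock p) = {..<height p}" "ran (lock p) \<subseteq> {..<2} \<times> UNIV"
    using p by (simp_all add: conds_def)
  have sel: "height q = M"
    "\<And>e. col q e = (if e \<in> [{..<M}]\<^bsup>2\<^esup> then
         if e \<in> [{..<height p}]\<^bsup>2\<^esup> then col p e
         else Some (case lock p (Min e) of Some (v, u) \<Rightarrow> v | None \<Rightarrow> 1)
       else None)"
    "\<And>x. lock q x = (if x < height p then lock p x else if x < M then Some (0, M) else None)"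
    by (simp_all add: q_def clashing_extension_def)
  have edge: "{x, y} \<in> [{..<n}]\<^bsup>2\<^esup> \<longleftrightarrow> y < n" if "x < y" for x y n :: nat
    using that by (auto simp: nsets_def)
  have none: "lock p x = None" if "height p \<le> x" for x
  proof -
    have "x \<notin> dom (lock p)" unfolding pc(3) using that by simp
    then show ?thesis unfolding domIff by blast
  qed
  show "height q = M" by (rule sel(1))
  show new: "col q {x, y} = Some 1" if "height p \<le> x" "x < y" "y < M"
    using that by (simp add: sel(2) edge none min_def)
  show lock: "lock q x = Some (0, M)" if "height p \<le> x" "x < M"
    using that by (simp add: sel(3))
  have sub: "[{..<height p}]\<^bsup>2\<^esup> \<subseteq> [{..<M}]\<^bsup>2\<^esup>" using M by (intro nsets_mono) auto
  show "extends q p"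
    unfolding extends_def map_le_def
    using M pc(1,3) sub by (auto simp: sel)
  show "q \<in> conds"
    unfolding conds_def mem_Collect_eq sel(1)
  proof (intro conjI allI impI)
    show "dom (col q) = [{..<M}]\<^bsup>2\<^esup>"
      using pc(1) sub by (auto simp: dom_def sel(2))
    show "ran (col q) \<subseteq> {..<2}"
    proof
      fix v assume "v \<in> ran (col q)"
      then obtain e where "col q e = Some v" by (auto simp: ran_def)
      then show "v \<in> {..<2}"
        using pc(2,4) by (fastforce simp: sel(2) ran_def split: if_splits option.splits)
    qed
    show "dom (lock q) = {..<M}"
      using pc(3) M by (auto simp: dom_def sel(3))
    show "ran (lock q) \<subseteq> {..<2} \<times> UNIV"
      using pc(4) by (fastforce simp: ran_def sel(3) split: if_splits)
    fix x v u y assume xv: "lock q x = Some (v, u)" and y: "x < y \<and> u \<le> y \<and> y < M"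
    show "col q {x, y} = Some v"
    proof (cases "x < height p")
      case True
      then have l: "lock p x = Some (v, u)" using xv by (simp add: sel(3))
      have "col p {x, y} = Some v" if "y < height p"
        using condsD(5)[OF p l] y that by simp
      then show ?thesis using l y by (simp add: sel(2) edge min_def)
    qed (use xv y in \<open>auto simp: sel(3) split: if_splits\<close>)
  qed
qed

text \<open>The computation is merged with one that yields the correct value of the characteristic
  function, and \<open>computation_unique\<close> compares the two.\<close>

lemma computes_index_derives_1:
  assumes "computes_index L e (\<lambda>n. Some (if n \<in> H then 1 else 0))"
    and "computation L d" "derives d e x 1"
  shows "x \<in> H"
proof -
  obtain d' where d': "computation L d'" "derives d' e x (if x \<in> H then 1 else 0)"
    using computes_indexD[OF assms(1)] by blast
  let ?D = "set_encode (set_decode d \<union> set_decode d')"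
  have "derives ?D e x 1" "derives ?D e x (if x \<in> H then 1 else 0)"
    using assms(3) d'(2) by simp_all
  from computation_unique[OF computation_union[OF assms(2) d'(1)] this] show ?thesis
    by (simp split: if_splits)
qed


text \<open>\<open>column_Suc\<close> is what \<open>PA_over_columns\<close> provides.
  \<open>infinite_Int\<close> keeps every color of \<open>J\<close> available in each infinite
  reservoir that \<open>J\<close> covers; it is obtained by taking \<open>J\<close> of least
  possible size.\<close>

locale reservoirs =
  fixes X R J :: "nat set" and c :: "nat set \<Rightarrow> nat" and A :: "nat \<Rightarrow> nat set"
  assumes generic: "one_generic X c"
    and computes_R: "computes X R"
    and column_Suc: "\<And>i p n. (\<And>n. \<exists>C\<subseteq>{..<n}. nonsplitting_class p n (column R i \<inter> {..<n}) C) \<Longrightarrow>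
      nonsplitting_class p n (column R i \<inter> {..<n}) (column R (Suc \<langle>i, p\<rangle>) \<inter> {..<n})"
    and finite_J: "finite J"
    and infinite_Int: "\<And>i j s h. infinite (reservoir R i j s) \<Longrightarrow> reservoir R i j s \<subseteq> (\<Union>h\<in>J. A h) \<Longrightarrow>
      h \<in> J \<Longrightarrow> infinite (reservoir R i j s \<inter> A h)"
begin

section \<open>Stages of the construction and their refinement\<close>

definition stage :: "(nat \<Rightarrow> nat set) \<Rightarrow> nat \<Rightarrow> nat \<Rightarrow> nat \<Rightarrow> bool" where
  "stage F i j s \<longleftrightarrow> (\<forall>h\<in>J. F h \<subseteq> A h \<inter> {..<s}) \<and> infinite (reservoir R i j s) \<and>
     reservoir R i j s \<subseteq> (\<Union>h\<in>J. A h)"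

definition refines ::
    "(nat \<Rightarrow> nat set) \<Rightarrow> nat set \<Rightarrow> (nat \<Rightarrow> nat set) \<Rightarrow> nat set \<Rightarrow> bool" where
  "refines F' Z' F Z \<longleftrightarrow> (\<forall>h\<in>J. F h \<subseteq> F' h \<and> F' h \<subseteq> F h \<union> Z) \<and> Z' \<subseteq> Z"

text \<open>The sets \<open>L\<close> are those compatible with a finite part and a reservoir, as
  for Mathias conditions, so refinement preserves the property. One color per assignment
  suffices.\<close>

definition defeats :: "(nat \<Rightarrow> nat set) \<Rightarrow> nat set \<Rightarrow> (nat \<Rightarrow> nat) \<Rightarrow> bool" where
  "defeats F Z \<epsilon> \<longleftrightarrow> (\<exists>h\<in>J. \<forall>L H. F h \<subseteq> L \<and> L \<subseteq> F h \<union> Z \<and> infinite H \<and> homogeneous c H \<longrightarrow>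
     \<not> computes_index L (\<epsilon> h) (\<lambda>n. Some (if n \<in> H then 1 else 0)))"

lemma refines_refl: "refines F Z F Z"
  by (auto simp: refines_def)

lemma refines_trans: "refines F'' Z'' F' Z' \<Longrightarrow> refines F' Z' F Z \<Longrightarrow> refines F'' Z'' F Z"
  unfolding refines_def by blast

lemma defeats_refines:
  assumes "defeats F Z \<epsilon>" "refines F' Z' F Z"
  shows "defeats F' Z' \<epsilon>"
proof -
  from assms(1) obtain h where h: "h \<in> J" "\<forall>L H. F h \<subseteq> L \<and> L \<subseteq> F h \<union> Z \<and> infinite H \<and>
      homogeneous c H \<longrightarrow> \<not> computes_index L (\<epsilon> h) (\<lambda>n. Some (if n \<in> H then 1 else 0))"
    unfolding defeats_def by blast
  have sub: "F h \<subseteq> F' h" "F' h \<subseteq> F h \<union> Z" "Z' \<subseteq> Z" using assms(2) h(1) by (auto simp: refines_def)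
  show ?thesis
    unfolding defeats_def
  proof (intro bexI[OF _ h(1)] allI impI)
    fix L H assume LH: "F' h \<subseteq> L \<and> L \<subseteq> F' h \<union> Z' \<and> infinite H \<and> homogeneous c H"
    then have "F h \<subseteq> L" "L \<subseteq> F h \<union> Z" using sub by auto
    with LH h(2) show "\<not> computes_index L (\<epsilon> h) (\<lambda>n. Some (if n \<in> H then 1 else 0))" by simp
  qed
qed

text \<open>By \<open>infinite_Int\<close> every color of \<open>J\<close> still has points beyond
  \<open>n\<close> in the reservoir. Repeated growth makes the final sets infinite.\<close>

lemma ex_stage_grow:
  assumes st: "stage F i j s"
  shows "\<exists>F' s'. stage F' i j s' \<and> refines F' (reservoir R i j s') F (reservoir R i j s) \<and>
    (\<forall>h\<in>J. \<exists>z\<in>F' h. n \<le> z)"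
proof -
  have "\<exists>z. z \<in> reservoir R i j s \<inter> A h \<and> n \<le> z" if "h \<in> J" for h
    using infinite_Int[OF _ _ that, of i j s] st
    unfolding stage_def infinite_nat_iff_unbounded_le by blast
  then obtain z where z: "\<And>h. h \<in> J \<Longrightarrow> z h \<in> reservoir R i j s \<inter> A h \<and> n \<le> z h" by metis
  obtain m where m: "z ` J \<subseteq> {..<m}"
    using finite_nat_bounded[OF finite_imageI[OF finite_J]] by blast
  let ?s = "max s m" and ?F = "\<lambda>h. insert (z h) (F h)"
  have sub: "reservoir R i j ?s \<subseteq> reservoir R i j s" by (rule reservoir_antimono) simp
  have "stage ?F i j ?s"
    unfolding stage_def
  proof (intro conjI ballI)
    fix h assume h: "h \<in> J"
    then have "F h \<subseteq> A h \<inter> {..<s}" "z h < m" using st m by (auto simp: stage_def)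
    with z[OF h] show "?F h \<subseteq> A h \<inter> {..<?s}" by auto
  next
    show "infinite (reservoir R i j ?s)" using st infinite_reservoir by (auto simp: stage_def)
    show "reservoir R i j ?s \<subseteq> (\<Union>h\<in>J. A h)" using st sub by (auto simp: stage_def)
  qed
  moreover have "refines ?F (reservoir R i j ?s) F (reservoir R i j s)"
    using z sub by (auto simp: refines_def)
  moreover have "\<forall>h\<in>J. \<exists>z\<in>?F h. n \<le> z" using z by auto
  ultimately show ?thesis by blast
qed

section \<open>Defeating one assignment of indices\<close>

lemma splitting_intro:
  assumes a: "set_decode a = (\<lambda>h. \<langle>h, \<epsilon> h\<rangle>) ` J"
    and b: "set_decode b = (\<lambda>(h, z). \<langle>h, z\<rangle>) ` (SIGMA h:J. F h)"
    and h: "h \<in> J" and "F h \<subseteq> E" and E: "\<And>z. z \<in> E \<Longrightarrow> z \<in> F h \<or> \<langle>h, z\<rangle> \<in> C"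
    and "computation E d" "x < y" "derives d (\<epsilon> h) x 1" "derives d (\<epsilon> h) y 1"
  shows "splitting a b C E d x y"
proof -
  have "\<langle>h, \<epsilon> h\<rangle> \<in> set_decode a" using a h by blast
  moreover have "\<forall>q\<in>set_decode b. cfst q = h \<longrightarrow> csnd q \<in> E"
    using b \<open>F h \<subseteq> E\<close> by auto
  moreover have "\<langle>h, z\<rangle> \<in> set_decode b \<or> \<langle>h, z\<rangle> \<in> C" if "z \<in> E" for z
    using E[OF that] h b by force
  ultimately show ?thesis
    using assms(6-9) unfolding splitting_def by (intro conjI bexI[of _ "\<langle>h, \<epsilon> h\<rangle>"]) simp_all
qed

lemma splittingE:
  assumes a: "set_decode a = (\<lambda>h. \<langle>h, \<epsilon> h\<rangle>) ` J"
    and b: "set_decode b = (\<lambda>(h, z). \<langle>h, z\<rangle>) ` (SIGMA h:J. F h)"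
    and sp: "splitting a b C E d x y"
  obtains h where "h \<in> J" "F h \<subseteq> E" "\<And>z. z \<in> E \<Longrightarrow> z \<in> F h \<or> \<langle>h, z\<rangle> \<in> C"
    "computation E d" "x < y" "derives d (\<epsilon> h) x 1" "derives d (\<epsilon> h) y 1"
proof -
  from sp obtain t where t: "t \<in> set_decode a" "\<forall>q\<in>set_decode b. cfst q = cfst t \<longrightarrow> csnd q \<in> E"
    "\<forall>z\<in>E. \<langle>cfst t, z\<rangle> \<in> set_decode b \<or> \<langle>cfst t, z\<rangle> \<in> C" "derives d (csnd t) x 1" "derives d (csnd t) y 1"
    and d: "computation E d" "x < y" unfolding splitting_def by blast
  from t(1) a obtain h where h: "h \<in> J" "t = \<langle>h, \<epsilon> h\<rangle>" by blast
  have "F h \<subseteq> E"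
  proof
    fix z assume "z \<in> F h"
    with h(1) b have "\<langle>h, z\<rangle> \<in> set_decode b" by force
    with t(2) h(2) show "z \<in> E" by fastforce
  qed
  moreover have "z \<in> F h \<or> \<langle>h, z\<rangle> \<in> C" if "z \<in> E" for z
    using t(3) that h(2) b by fastforce
  ultimately show ?thesis using that[OF h(1)] d t(4,5) h(2) by simp
qed

text \<open>
  A color that differs from the lock on the smaller point can be met only finitely often, so an
  infinite set containing the pair is not homogeneous.
\<close>

lemma defeats_if_clash:
  assumes st: "stage F i j s"
    and a: "set_decode a = (\<lambda>h. \<langle>h, \<epsilon> h\<rangle>) ` J"
    and b: "set_decode b = (\<lambda>(h, z). \<langle>h, z\<rangle>) ` (SIGMA h:J. F h)"
    and p: "p \<in> conds" "coloring_extends c p"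
    and clash: "\<And>C. C \<subseteq> {..<m} \<Longrightarrow> partitions a j s m (column R i) C \<Longrightarrow>
      \<exists>d e x y v w u. splitting a b C (set_decode e) d x y \<and> d < m \<and> e < m \<and>
        lock p x = Some (v, u) \<and> col p {x, y} = Some w \<and> w \<noteq> v"
  shows "\<exists>F' s'. stage F' i j s' \<and> refines F' (reservoir R i j s') F (reservoir R i j s) \<and>
    defeats F' (reservoir R i j s') \<epsilon>"
proof -
  let ?Z = "reservoir R i j s"
  \<comment> \<open>The partition of the reservoir induced by the sets \<open>A h\<close>, truncated
    below \<open>m\<close>.\<close>
  define C where "C = {\<langle>h, z\<rangle> |h z. h \<in> J \<and> z \<in> A h \<and> z \<in> ?Z} \<inter> {..<m}"
  have "partitions a j s m (column R i) C"
    unfolding partitions_def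
  proof (intro conjI allI ballI impI)
    fix z assume "z < m"
      and z: "(\<forall>t\<in>set_decode a. \<langle>cfst t, z\<rangle> < m) \<and> s \<le> z \<and> \<langle>j, z\<rangle> < m \<and> \<langle>j, z\<rangle> \<in> column R i"
    then have "z \<in> ?Z" by (simp add: reservoir_def)
    with st obtain h where h: "h \<in> J" "z \<in> A h" by (auto simp: stage_def)
    have "\<langle>h, \<epsilon> h\<rangle> \<in> set_decode a" using a h(1) by blast
    moreover from this z have "\<langle>h, z\<rangle> < m" by fastforce
    ultimately show "\<exists>t\<in>set_decode a. \<langle>cfst t, z\<rangle> \<in> C"
      using h \<open>z \<in> ?Z\<close> by (intro bexI[of _ "\<langle>h, \<epsilon> h\<rangle>"]) (auto simp: C_def)
  qed (auto simp: C_def reservoir_def)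
  then obtain d e x y v w u where sp: "splitting a b C (set_decode e) d x y" "d < m" "e < m"
    and vw: "lock p x = Some (v, u)" "col p {x, y} = Some w" "w \<noteq> v"
    using clash[of C] by (auto simp: C_def)
  \<comment> \<open>Starting the new reservoir at \<open>max s m\<close> puts it above
    \<open>d\<close> and above all of \<open>?E\<close>.\<close>
  let ?E = "set_decode e" and ?s = "max s m"
  obtain h where h: "h \<in> J" "F h \<subseteq> ?E" "\<And>z. z \<in> ?E \<Longrightarrow> z \<in> F h \<or> \<langle>h, z\<rangle> \<in> C"
    "computation ?E d" "x < y" "derives d (\<epsilon> h) x 1" "derives d (\<epsilon> h) y 1"
    using splittingE[OF a b sp(1)] by metis
  have Fh: "F h \<subseteq> A h" using st h(1) by (auto simp: stage_def)
  have E: "z \<in> F h \<or> z \<in> A h \<inter> ?Z" if "z \<in> ?E" for z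
    using h(3)[OF that] by (auto simp: C_def)
  have Em: "?E \<subseteq> {..<m}" using mem_set_decode_less sp(3) by fastforce
  let ?F = "F(h := ?E)"
  have sub: "reservoir R i j ?s \<subseteq> ?Z" by (rule reservoir_antimono) simp
  have "stage ?F i j ?s"
    unfolding stage_def
  proof (intro conjI ballI)
    fix h' assume "h' \<in> J"
    then have "F h' \<subseteq> A h' \<inter> {..<s}" using st by (auto simp: stage_def)
    moreover have "?E \<subseteq> A h \<inter> {..<?s}" using E Em Fh by fastforce
    ultimately show "?F h' \<subseteq> A h' \<inter> {..<?s}" by (cases "h' = h") auto
  next
    show "infinite (reservoir R i j ?s)" using st infinite_reservoir by (auto simp: stage_def)
    show "reservoir R i j ?s \<subseteq> (\<Union>h\<in>J. A h)" using st sub by (auto simp: stage_def)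
  qed
  moreover have "refines ?F (reservoir R i j ?s) F ?Z"
    unfolding refines_def using h(2) E sub by auto
  moreover have "defeats ?F (reservoir R i j ?s) \<epsilon>"
    unfolding defeats_def
  proof (intro bexI[OF _ h(1)] allI impI notI)
    fix L H
    assume LH: "?F h \<subseteq> L \<and> L \<subseteq> ?F h \<union> reservoir R i j ?s \<and> infinite H \<and> homogeneous c H"
      and comp: "computes_index L (\<epsilon> h) (\<lambda>n. Some (if n \<in> H then 1 else 0))"
    \<comment> \<open>The new reservoir contributes nothing below \<open>d\<close>, so by the use
      principle \<open>d\<close> is a computation from \<open>L\<close> too.\<close>
    have "x \<in> ?E \<longleftrightarrow> x \<in> L" if "x < d" for x
      using LH that sp(2) by (auto simp: reservoir_def)
    then have "computation L d" using computation_cong[OF h(4)] by blast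
    with h(6,7) comp have xy: "x \<in> H" "y \<in> H" using computes_index_derives_1 by blast+
    \<comment> \<open>A point \<open>z\<close> of \<open>H\<close> beyond the threshold of the lock
      gives \<open>{x, z}\<close> the color \<open>v\<close>, whereas \<open>{x, y}\<close> has the
      color \<open>w\<close>.\<close>
    from LH obtain z where z: "z \<in> H" "max (Suc x) u \<le> z"
      unfolding infinite_nat_iff_unbounded_le by blast
    have "c {x, z} = v"
      using p(2) vw(1) z(2) unfolding coloring_extends_def by auto
    moreover have "c {x, y} = w"
      using p(2) vw(2) unfolding coloring_extends_def map_le_def by (metis domI option.inject)
    moreover have "{x, y} \<in> [H]\<^bsup>2\<^esup>" "{x, z} \<in> [H]\<^bsup>2\<^esup>"
      using xy z h(5) by (auto simp: nsets_def)
    ultimately show False using LH vw(3) unfolding homogeneous_def by metis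
  qed
  ultimately show ?thesis by blast
qed

text \<open>The coded parts cover the reservoir, so one of them is infinite and replaces it. If an
  admissible \<open>L\<close> computed an infinite \<open>H\<close>, two elements of
  \<open>H\<close> from \<open>N\<close> on would give a splitting with a finite piece of
  \<open>L\<close>.\<close>

lemma defeats_if_nonsplitting:
  assumes st: "stage F i j s"
    and a: "set_decode a = (\<lambda>h. \<langle>h, \<epsilon> h\<rangle>) ` J"
    and b: "set_decode b = (\<lambda>(h, z). \<langle>h, z\<rangle>) ` (SIGMA h:J. F h)"
    and ns: "\<And>n. nonsplitting a b j s N n (column R i \<inter> {..<n}) (column R i' \<inter> {..<n})"
  shows "\<exists>j'. stage F i' j' s \<and> refines F (reservoir R i' j' s) F (reservoir R i j s) \<and>
    defeats F (reservoir R i' j' s) \<epsilon>"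
proof -
  have sub: "reservoir R i' h s \<subseteq> reservoir R i j s" if h: "h \<in> J" for h
  proof
    fix z assume "z \<in> reservoir R i' h s"
    then have z: "\<langle>h, z\<rangle> \<in> column R i'" by (simp add: reservoir_def)
    \<comment> \<open>Large enough for the second clause of \<open>partitions\<close> to apply to
      \<open>z\<close>.\<close>
    define n where "n = Suc (max z (max \<langle>h, z\<rangle> \<langle>j, z\<rangle>))"
    have n: "z < n" "\<langle>h, z\<rangle> < n" "\<langle>j, z\<rangle> < n" by (simp_all add: n_def)
    have "\<langle>h, \<epsilon> h\<rangle> \<in> set_decode a" using a h by blast
    moreover have "partitions a j s n (column R i \<inter> {..<n}) (column R i' \<inter> {..<n})"
      using ns[of n] by (simp add: nonsplitting_def)
    ultimately have "s \<le> z \<and> \<langle>j, z\<rangle> \<in> column R i \<inter> {..<n}"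
      using n z unfolding partitions_def by fastforce
    then show "z \<in> reservoir R i j s" by (simp add: reservoir_def)
  qed
  have "reservoir R i j s \<subseteq> (\<Union>h\<in>J. reservoir R i' h s)"
  proof
    fix z assume "z \<in> reservoir R i j s"
    then have z: "\<langle>j, z\<rangle> \<in> column R i" "s \<le> z" by (simp_all add: reservoir_def)
    \<comment> \<open>The covering clause applies to \<open>z\<close> only once its codes under all
      colors in play lie below the level.\<close>
    obtain n0 where n0: "(\<lambda>t. \<langle>cfst t, z\<rangle>) ` set_decode a \<subseteq> {..<n0}"
      using finite_nat_bounded by (meson finite_imageI finite_set_decode)
    define n where "n = Suc (max n0 (max z \<langle>j, z\<rangle>))"
    have n: "z < n" "\<langle>j, z\<rangle> < n" "\<forall>t\<in>set_decode a. \<langle>cfst t, z\<rangle> < n"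
      using n0 by (auto simp: n_def less_Suc_eq less_max_iff_disj)
    have "partitions a j s n (column R i \<inter> {..<n}) (column R i' \<inter> {..<n})"
      using ns[of n] by (simp add: nonsplitting_def)
    then obtain t where t: "t \<in> set_decode a" "\<langle>cfst t, z\<rangle> \<in> column R i'"
      using n z unfolding partitions_def by blast
    from t(1) a obtain h where "h \<in> J" "t = \<langle>h, \<epsilon> h\<rangle>" by blast
    with t z show "z \<in> (\<Union>h\<in>J. reservoir R i' h s)" by (auto simp: reservoir_def)
  qed
  moreover have "infinite (reservoir R i j s)" using st by (simp add: stage_def)
  ultimately have "infinite (\<Union>h\<in>J. reservoir R i' h s)" using finite_subset by blast
  then obtain h where h: "h \<in> J" "infinite (reservoir R i' h s)" using finite_J by blast
  have "stage F i' h s" using st h sub[OF h(1)] unfolding stage_def by blast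
  moreover have "refines F (reservoir R i' h s) F (reservoir R i j s)"
    using sub[OF h(1)] by (auto simp: refines_def)
  moreover have "defeats F (reservoir R i' h s) \<epsilon>"
    unfolding defeats_def
  proof (intro bexI[OF _ h(1)] allI impI notI)
    fix L H
    assume LH: "F h \<subseteq> L \<and> L \<subseteq> F h \<union> reservoir R i' h s \<and> infinite H \<and> homogeneous c H"
      and comp: "computes_index L (\<epsilon> h) (\<lambda>n. Some (if n \<in> H then 1 else 0))"
    from LH obtain x where x: "x \<in> H" "N \<le> x"
      unfolding infinite_nat_iff_unbounded_le by blast
    from LH obtain y where y: "y \<in> H" "x < y"
      unfolding infinite_nat_iff_unbounded by blast
    from x y comp obtain d1 d2 where d1: "computation L d1" "derives d1 (\<epsilon> h) x 1"
      and d2: "computation L d2" "derives d2 (\<epsilon> h) y 1"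
      unfolding computes_index_def by (metis (full_types))
    define d where "d = set_encode (set_decode d1 \<union> set_decode d2)"
    have d: "computation L d" "derives d (\<epsilon> h) x 1" "derives d (\<epsilon> h) y 1"
      using d1 d2 computation_union[OF d1(1) d2(1)] by (simp_all add: d_def)
    \<comment> \<open>The finite piece must contain \<open>F h\<close>, which lies below
      \<open>s\<close>, and agree with \<open>L\<close> on the use, which lies below
      \<open>d\<close>.\<close>
    define m where "m = max d s"
    define E where "E = L \<inter> {..<m}"
    have finE: "finite E" by (simp add: E_def)
    have "computation E d"
      by (rule computation_cong[OF d(1)]) (auto simp: E_def m_def)
    \<comment> \<open>This level exceeds all witnesses and all codes
      \<open>\<langle>h, z\<rangle>\<close> with \<open>z < m\<close>.\<close>
    define n where "n = Suc (set_encode E + d + x + y + \<langle>h, m\<rangle>)"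
    have "splitting a b (column R i' \<inter> {..<n}) E d x y"
    proof (rule splitting_intro[OF a b h(1)])
      have "F h \<subseteq> {..<s}" using st h(1) by (auto simp: stage_def)
      then show "F h \<subseteq> E" using LH by (auto simp: E_def m_def)
      show "z \<in> F h \<or> \<langle>h, z\<rangle> \<in> column R i' \<inter> {..<n}" if "z \<in> E" for z
      proof -
        have "z \<in> F h \<or> z \<in> reservoir R i' h s" "z < m" using that LH by (auto simp: E_def)
        moreover have "\<langle>h, z\<rangle> < n"
          using cpair_mono[of h h z m] \<open>z < m\<close> by (simp add: n_def)
        ultimately show ?thesis by (auto simp: reservoir_def)
      qed
    qed fact+
    moreover have "\<not> splitting a b (column R i' \<inter> {..<n}) (set_decode (set_encode E)) d x y"
      using ns[of n] x(2) unfolding nonsplitting_def by (simp add: n_def)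
    ultimately show False using finE by simp
  qed
  ultimately show ?thesis by blast
qed

text \<open>Genericity decides the class of conditions that have a clash for every partition.
  Meeting the class leads to \<open>defeats_if_clash\<close>; avoiding it yields, through clashing
  extensions, nonsplitting partitions at all levels and thus one in a column of
  \<open>R\<close>.\<close>

lemma ex_stage_defeats:
  assumes st: "stage F i j s"
  shows "\<exists>F' i' j' s'. stage F' i' j' s' \<and>
    refines F' (reservoir R i' j' s') F (reservoir R i j s) \<and> defeats F' (reservoir R i' j' s') \<epsilon>"
proof -
  define a where "a = set_encode ((\<lambda>h. \<langle>h, \<epsilon> h\<rangle>) ` J)"
  define b where "b = set_encode ((\<lambda>(h, z). \<langle>h, z\<rangle>) ` (SIGMA h:J. F h))"
  have a: "set_decode a = (\<lambda>h. \<langle>h, \<epsilon> h\<rangle>) ` J"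
    using finite_J by (simp add: a_def)
  have "finite (F h)" if "h \<in> J" for h
    using st that unfolding stage_def by (meson finite_Int finite_lessThan finite_subset)
  then have b: "set_decode b = (\<lambda>(h, z). \<langle>h, z\<rangle>) ` (SIGMA h:J. F h)"
    using finite_J by (simp add: b_def)
  \<comment> \<open>\<open>x\<close> is the code of a condition and \<open>m\<close> the bound that
    compactness allows: only partitions truncated at \<open>m\<close> are tested. So
    \<open>S\<close> is decidable in \<open>X\<close>, and quantifying over \<open>m\<close> gives a
    class to which genericity applies.\<close>
  define S where "S x m \<longleftrightarrow> (\<forall>C\<subseteq>{..<m}. partitions a j s m (column R i) C \<longrightarrow>
    (\<exists>d<m. \<exists>e<m. \<exists>x'<m. \<exists>y<m. splitting a b C (set_decode e) d x' y \<and>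
      (\<exists>t\<in>set_decode (lock_code x). cfst t = x' \<and>
        (\<exists>w<2. \<langle>edge_code x' y, w\<rangle> \<in> set_decode (col_code x) \<and> w \<noteq> cfst (csnd t)))))" for x m
  have "decidable_in X (\<lambda>z. S (cfst z) (csnd z))"
    unfolding S_def all_subset_lessThan_iff partitions_def splitting_def column_def mem_Collect_eq
    by (intro recursive_intros decidable_oracle[OF computes_R])
  then have "sigma1_in X (cond_code ` {q \<in> conds. \<exists>m. S (cond_code q) m})"
    by (rule sigma1_in_cond_code)
  then obtain p where p: "p \<in> conds" "coloring_extends c p"
    and W: "p \<in> {q \<in> conds. \<exists>m. S (cond_code q) m} \<or>
      \<not> (\<exists>q\<in>{q \<in> conds. \<exists>m. S (cond_code q) m}. extends q p)"
    using generic[unfolded one_generic_def, rule_format, of "{q \<in> conds. \<exists>m. S (cond_code q) m}"]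
    by auto
  from W show ?thesis
  proof
    assume "p \<in> {q \<in> conds. \<exists>m. S (cond_code q) m}"
    then obtain m where m: "S (cond_code p) m" by blast
    have "\<exists>d e x y v w u. splitting a b C (set_decode e) d x y \<and> d < m \<and> e < m \<and>
        lock p x = Some (v, u) \<and> col p {x, y} = Some w \<and> w \<noteq> v"
      if C: "C \<subseteq> {..<m}" "partitions a j s m (column R i) C" for C
    proof -
      from m[unfolded S_def, rule_format, OF C]
      obtain d e x y t w where *: "d < m" "e < m" "splitting a b C (set_decode e) d x y"
        "t \<in> set_decode (lock_code (cond_code p))" "cfst t = x"
        "\<langle>edge_code x y, w\<rangle> \<in> set_decode (col_code (cond_code p))" "w \<noteq> cfst (csnd t)"
        by (elim exE conjE bexE) (rule that)
      from *(4,5) obtain v u where vu: "lock p x = Some (v, u)" "t = \<langle>x, \<langle>v, u\<rangle>\<rangle>"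
        by (auto simp: lock_code_iff[OF p(1)])
      have "col p {x, y} = Some w"
        using *(3,6) edge_mem_col_code_iff[OF p(1)] by (simp add: splitting_def)
      moreover have "w \<noteq> v" using vu(2) *(7) by simp
      ultimately show ?thesis using vu(1) *(1-3)
        by (intro exI[of _ d] exI[of _ e] exI[of _ x] exI[of _ y] exI[of _ v] exI[of _ w] exI[of _ u]
            conjI)
    qed
    from defeats_if_clash[OF st a b p this] show ?thesis by blast
  next
    assume no: "\<not> (\<exists>q\<in>{q \<in> conds. \<exists>m. S (cond_code q) m}. extends q p)"
    define r where "r = \<langle>a, \<langle>b, \<langle>j, \<langle>s, height p\<rangle>\<rangle>\<rangle>\<rangle>"
    have r: "nonsplitting_class r = nonsplitting a b j s (height p)"
      by (simp add: nonsplitting_class_def r_def)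
    have "\<exists>C\<subseteq>{..<n}. nonsplitting_class r n (column R i \<inter> {..<n}) C" for n
    proof -
      \<comment> \<open>All points below \<open>n\<close> have to be points of the extension of
        \<open>p\<close>.\<close>
      define M where "M = max n (height p)"
      define q where "q = clashing_extension p M"
      have "height p \<le> M" by (simp add: M_def)
      note q = clashing_extension[OF p(1) this, folded q_def]
      from no q(1,2) have "\<not> S (cond_code q) n" by blast
      then obtain C where C: "C \<subseteq> {..<n}" "partitions a j s n (column R i) C"
        and ns': "\<not> (\<exists>d<n. \<exists>e<n. \<exists>x<n. \<exists>y<n. splitting a b C (set_decode e) d x y \<and>
          (\<exists>t\<in>set_decode (lock_code (cond_code q)). cfst t = x \<and>
            (\<exists>w<2. \<langle>edge_code x y, w\<rangle> \<in> set_decode (col_code (cond_code q)) \<and> w \<noteq> cfst (csnd t))))"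
        unfolding S_def not_all not_imp by (elim exE conjE) (rule that)
      have ns: "\<And>d e x y t w. d < n \<Longrightarrow> e < n \<Longrightarrow> x < n \<Longrightarrow> y < n \<Longrightarrow>
          splitting a b C (set_decode e) d x y \<Longrightarrow> t \<in> set_decode (lock_code (cond_code q)) \<Longrightarrow>
          cfst t = x \<Longrightarrow> w < 2 \<Longrightarrow> \<langle>edge_code x y, w\<rangle> \<in> set_decode (col_code (cond_code q)) \<Longrightarrow>
          w = cfst (csnd t)"
        using ns' by blast
      have "\<not> splitting a b C (set_decode e) d x y"
        if "d < n" "e < n" "x < n" "y < n" "height p \<le> x" for d e x y
      proof
        assume sp: "splitting a b C (set_decode e) d x y"
        then have "x < y" by (simp add: splitting_def)
        then have "\<langle>edge_code x y, 1\<rangle> \<in> set_decode (col_code (cond_code q))"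
          using q(4) that edge_mem_col_code_iff[OF q(1)] by (simp add: M_def)
        moreover have "\<langle>x, \<langle>0, M\<rangle>\<rangle> \<in> set_decode (lock_code (cond_code q))"
          using q(5) that lock_mem_lock_code_iff[OF q(1)] by (simp add: M_def)
        \<comment> \<open>Color 1 against lock 0 is a clash that \<open>ns\<close> forbids.\<close>
        ultimately show False using ns[OF that(1-4) sp, of "\<langle>x, \<langle>0, M\<rangle>\<rangle>" 1] by simp
      qed
      with C show ?thesis
        unfolding r nonsplitting_def partitions_Int[OF order_refl] by blast
    qed
    \<comment> \<open>Solvability at every level passes to one partition, coded in column
      \<open>Suc \<langle>i, r\<rangle>\<close>.\<close>
    from column_Suc[OF this] have "nonsplitting a b j s (height p) n (column R i \<inter> {..<n})
        (column R (Suc \<langle>i, r\<rangle>) \<inter> {..<n})" for n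
      unfolding r .
    from defeats_if_nonsplitting[OF st a b this] show ?thesis by blast
  qed
qed

text \<open>Step \<open>n\<close> defeats the assignment coded by \<open>n\<close> and adds points
  for every color. If each limit \<open>L h\<close> computed an infinite homogeneous set, the
  indices witnessing this would form one assignment, contrary to the step that defeated it.\<close>

lemma ex_noncomputing_subset:
  assumes "infinite (reservoir R i j s)" "reservoir R i j s \<subseteq> (\<Union>h\<in>J. A h)"
  shows "\<exists>h\<in>J. \<exists>L\<subseteq>A h. infinite L \<and> \<not> (\<exists>H. infinite H \<and> homogeneous c H \<and> computes L H)"
proof -
  define Z where "Z = (\<lambda>(F :: nat \<Rightarrow> nat set, i, j, s). reservoir R i j s)"
  define st where "st = (\<lambda>(F, i, j, s). stage F i j s)"
  \<comment> \<open>As \<open>J\<close> is finite, every assignment agrees on \<open>J\<close> with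
    \<open>\<lambda>h. list_decode n ! h\<close> for some \<open>n\<close>.\<close>
  define next_stage where "next_stage n T T' \<longleftrightarrow> refines (fst T') (Z T') (fst T) (Z T) \<and>
    defeats (fst T') (Z T') (\<lambda>h. list_decode n ! h) \<and> (\<forall>h\<in>J. \<exists>z\<in>fst T' h. n \<le> z)" for n T T'
  have init: "\<exists>T. st T"
    using assms by (intro exI[of _ "(\<lambda>_. {}, i, j, s)"]) (simp add: stage_def st_def)
  have step: "\<exists>T'. st T' \<and> next_stage n T T'" if "st T" for T n
  proof -
    obtain F i j s where T: "T = (F, i, j, s)" by (cases T)
    with that have "stage F i j s" by (simp add: st_def)
    from ex_stage_defeats[OF this] obtain F1 i1 j1 s1 where st1: "stage F1 i1 j1 s1"
      and r1: "refines F1 (reservoir R i1 j1 s1) F (reservoir R i j s)"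
      and d1: "defeats F1 (reservoir R i1 j1 s1) (\<lambda>h. list_decode n ! h)" by blast
    from ex_stage_grow[OF st1] obtain F2 s2 where "stage F2 i1 j1 s2"
      and r2: "refines F2 (reservoir R i1 j1 s2) F1 (reservoir R i1 j1 s1)"
      and "\<forall>h\<in>J. \<exists>z\<in>F2 h. n \<le> z" by blast
    with refines_trans[OF r2 r1] defeats_refines[OF d1 r2] show ?thesis
      by (intro exI[of _ "(F2, i1, j1, s2)"]) (simp add: T st_def Z_def next_stage_def)
  qed
  obtain T where T_all: "\<And>n. st (T n) \<and> next_stage n (T n) (T (Suc n))"
    using dependent_nat_choice[of "\<lambda>_. st" next_stage, OF init step] by blast
  have st: "st (T n)" for n using T_all by blast
  have T: "refines (fst (T (Suc n))) (Z (T (Suc n))) (fst (T n)) (Z (T n))"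
    "defeats (fst (T (Suc n))) (Z (T (Suc n))) (\<lambda>h. list_decode n ! h)"
    "\<forall>h\<in>J. \<exists>z\<in>fst (T (Suc n)) h. n \<le> z" for n
    using T_all[of n] by (simp_all add: next_stage_def)
  define L where "L h = (\<Union>n. fst (T n) h)" for h
  have ref: "refines (fst (T (n + i))) (Z (T (n + i))) (fst (T n)) (Z (T n))" for n i
  proof (induction i)
    case (Suc i)
    then show ?case using refines_trans[OF T(1)[of "n + i"]] by simp
  qed (simp add: refines_refl)
  \<comment> \<open>The limits are thus among the sets that \<open>defeats\<close> quantifies over
    at each stage.\<close>
  have L: "fst (T n) h \<subseteq> L h" "L h \<subseteq> fst (T n) h \<union> Z (T n)" if h: "h \<in> J" for n h
  proof -
    show "fst (T n) h \<subseteq> L h" by (auto simp: L_def)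
    have "fst (T m) h \<subseteq> fst (T n) h \<union> Z (T n)" for m
    proof (cases "n \<le> m")
      case True
      then show ?thesis using ref[of n "m - n"] h by (auto simp: refines_def)
    next
      case False
      then show ?thesis using ref[of m "n - m"] h by (auto simp: refines_def)
    qed
    then show "L h \<subseteq> fst (T n) h \<union> Z (T n)" unfolding L_def by (rule UN_least)
  qed
  have LA: "L h \<subseteq> A h" if "h \<in> J" for h
  proof -
    have "fst (T n) h \<subseteq> A h" for n
      using st[of n] that by (cases "T n") (auto simp: st_def stage_def)
    then show ?thesis unfolding L_def by (rule UN_least)
  qed
  have infL: "infinite (L h)" if "h \<in> J" for h
    unfolding infinite_nat_iff_unbounded_le
  proof
    fix m
    from T(3)[of m] that obtain z where "z \<in> fst (T (Suc m)) h" "m \<le> z" by blast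
    then show "\<exists>z\<ge>m. z \<in> L h" unfolding L_def by blast
  qed
  show ?thesis
  proof (rule ccontr)
    assume no: "\<not> ?thesis"
    have "\<exists>H. infinite H \<and> homogeneous c H \<and> computes (L h) H" if h: "h \<in> J" for h
    proof (rule ccontr)
      assume "\<not> (\<exists>H. infinite H \<and> homogeneous c H \<and> computes (L h) H)"
      with LA[OF h] infL[OF h]
      have ex: "\<exists>L\<subseteq>A h. infinite L \<and> \<not> (\<exists>H. infinite H \<and> homogeneous c H \<and> computes L H)"
        by (intro exI[of _ "L h"] conjI)
      show False by (rule notE[OF no], rule bexI, rule ex, rule h)
    qed
    then obtain H where H: "\<And>h. h \<in> J \<Longrightarrow> infinite (H h) \<and> homogeneous c (H h) \<and> computes (L h) (H h)"
      by metis
    have "\<exists>e. computes_index (L h) e (\<lambda>n. Some (if n \<in> H h then 1 else 0))" if "h \<in> J" for h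
      using H[OF that] by (intro partrec_in_computes_index) (simp add: computes_def fun_computable_in_def)
    then obtain \<epsilon> where \<epsilon>: "\<And>h. h \<in> J \<Longrightarrow> computes_index (L h) (\<epsilon> h) (\<lambda>n. Some (if n \<in> H h then 1 else 0))"
      by metis
    \<comment> \<open>The indices for all colors are collected in one list, whose code is the number
      of the contradictory step.\<close>
    obtain k where k: "J \<subseteq> {..<k}" using finite_nat_bounded[OF finite_J] by blast
    define n where "n = list_encode (map \<epsilon> [0..<k])"
    have n: "list_decode n ! h = \<epsilon> h" if "h \<in> J" for h
      using k that by (auto simp: n_def)
    from T(2)[of n] obtain h where h: "h \<in> J" "\<forall>L' H. fst (T (Suc n)) h \<subseteq> L' \<and>
        L' \<subseteq> fst (T (Suc n)) h \<union> Z (T (Suc n)) \<and> infinite H \<and> homogeneous c H \<longrightarrow>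
        \<not> computes_index L' (list_decode n ! h) (\<lambda>n. Some (if n \<in> H then 1 else 0))"
      unfolding defeats_def by (elim bexE) (rule that)
    have "\<not> computes_index (L h) (\<epsilon> h) (\<lambda>n. Some (if n \<in> H h then 1 else 0))"
      using h(2)[rule_format, of "L h" "H h"] L[OF h(1), of "Suc n"] H[OF h(1)]
      unfolding n[OF h(1)] by blast
    with \<epsilon>[OF h(1)] show False by simp
  qed
qed

end

section \<open>From the construction to stable colorings\<close>

theorem theorem3p4:
  fixes X Y :: "nat set" and c d :: "nat set \<Rightarrow> nat" and k :: nat
  assumes "X \<ggreater> {}"
    and "c \<in> [UNIV]\<^bsup>2\<^esup> \<rightarrow> {..<2}" and "one_generic X c"
    and "k \<ge> 2"
    and "infinite Y" and "X \<ggreater> Y"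
    and "d \<in> [Y]\<^bsup>2\<^esup> \<rightarrow> {..<k}" and "stable_on d Y"
  shows "\<exists>L. infinite L \<and> L \<subseteq> Y \<and> limit_homogeneous d Y k L \<and>
           \<not> (\<exists>H. infinite H \<and> homogeneous c H \<and> computes L H)"
proof -
  define A where "A h = {x \<in> Y. lim_color d Y x h}" for h
  have A_Union: "Y \<subseteq> (\<Union>h<k. A h)"
  proof
    fix x assume x: "x \<in> Y"
    with assms(8) obtain h m where m: "\<And>y. y \<in> Y \<Longrightarrow> m < y \<Longrightarrow> d {x, y} = h" and h: "lim_color d Y x h"
      unfolding stable_on_def lim_color_def by blast
    \<comment> \<open>As \<open>Y\<close> is infinite, the limit color is attained by an actual pair
      and hence is below \<open>k\<close>.\<close>
    from assms(5) obtain y where y: "y \<in> Y" "max m x < y"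
      unfolding infinite_nat_iff_unbounded by blast
    then have "{x, y} \<in> [Y]\<^bsup>2\<^esup>" using x by (auto simp: nsets_def)
    with assms(7) have "d {x, y} < k" by auto
    with m[OF y(1)] y(2) have "h < k" by simp
    with x h show "x \<in> (\<Union>h<k. A h)" by (auto simp: A_def)
  qed
  \<comment> \<open>\<open>Y\<close> is coded as the part for color 0, so that
    \<open>reservoir R 0 0 0\<close> is \<open>Y\<close>.\<close>
  define B where "B = {n. cfst n = 0 \<and> csnd n \<in> Y}"
  have YY: "computes Y Y"
    unfolding computes_def fun_computable_in_def by (rule partrec_in.query)
  have "decidable_in Y (\<lambda>n. cfst n = 0 \<and> csnd n \<in> Y)"
    by (intro recursive_intros decidable_oracle[OF YY])
  then have "computes Y B" unfolding computes_iff B_def mem_Collect_eq .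
  then have "\<exists>R. computes X R \<and> column R 0 = B \<and>
    (\<forall>i p. (\<forall>n. \<exists>C\<subseteq>{..<n}. nonsplitting_class p n (column R i \<inter> {..<n}) C) \<longrightarrow>
      (\<forall>n. nonsplitting_class p n (column R i \<inter> {..<n}) (column R (Suc \<langle>i, p\<rangle>) \<inter> {..<n})))"
    by (rule PA_over_columns[OF assms(6) _ decidable_nonsplitting_class]) (rule nonsplitting_class_mono)
  then obtain R where R: "computes X R" "column R 0 = B"
    and col: "\<forall>i p. (\<forall>n. \<exists>C\<subseteq>{..<n}. nonsplitting_class p n (column R i \<inter> {..<n}) C) \<longrightarrow>
      (\<forall>n. nonsplitting_class p n (column R i \<inter> {..<n}) (column R (Suc \<langle>i, p\<rangle>) \<inter> {..<n}))"
    by (elim exE conjE) (rule that)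
  \<comment> \<open>A set of colors is good if it covers some infinite reservoir. Least cardinality
    yields \<open>infinite_Int\<close>: a color with only finitely many points in a covered infinite
    reservoir could be dropped after cutting these points off.\<close>
  define good where "good J \<longleftrightarrow> J \<subseteq> {..<k} \<and>
    (\<exists>i j s. infinite (reservoir R i j s) \<and> reservoir R i j s \<subseteq> (\<Union>h\<in>J. A h))" for J
  have "reservoir R 0 0 0 = Y" by (simp add: reservoir_def R(2) B_def)
  with A_Union assms(5) have "good {..<k}" unfolding good_def by blast
  then obtain J where J: "good J" "\<And>J'. good J' \<Longrightarrow> card J \<le> card J'"
    using ex_has_least_nat[of good "{..<k}" card] by blast
  from J(1) obtain i j s where Jk: "J \<subseteq> {..<k}"
    and ijs: "infinite (reservoir R i j s)" "reservoir R i j s \<subseteq> (\<Union>h\<in>J. A h)"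
    unfolding good_def by blast
  have finJ: "finite J" using Jk finite_subset by blast
  interpret reservoirs X R J c A
  proof
    show "one_generic X c" by fact
    show "computes X R" by (rule R(1))
    show "finite J" by (rule finJ)
    show "nonsplitting_class p n (column R i \<inter> {..<n}) (column R (Suc \<langle>i, p\<rangle>) \<inter> {..<n})"
      if "\<And>n. \<exists>C\<subseteq>{..<n}. nonsplitting_class p n (column R i \<inter> {..<n}) C" for i p n
      using col that by blast
    show "infinite (reservoir R i j s \<inter> A h)"
      if Z: "infinite (reservoir R i j s)" "reservoir R i j s \<subseteq> (\<Union>h\<in>J. A h)" "h \<in> J" for i j s h
    proof
      assume "finite (reservoir R i j s \<inter> A h)"
      then obtain m where m: "reservoir R i j s \<inter> A h \<subseteq> {..<m}"
        using finite_nat_bounded by blast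
      have "reservoir R i j (max s m) \<subseteq> (\<Union>h\<in>J - {h}. A h)"
      proof
        fix z assume "z \<in> reservoir R i j (max s m)"
        then have "z \<in> reservoir R i j s" "m \<le> z" by (auto simp: reservoir_def)
        with Z(2) m show "z \<in> (\<Union>h\<in>J - {h}. A h)" by fastforce
      qed
      moreover have "infinite (reservoir R i j (max s m))" using Z(1) by (rule infinite_reservoir)
      ultimately have "good (J - {h})" using Jk unfolding good_def by blast
      from J(2)[OF this] show False using card_Diff1_less[OF finJ Z(3)] by simp
    qed
  qed
  from ex_noncomputing_subset[OF ijs] obtain h L where "h \<in> J" "L \<subseteq> A h" "infinite L"
    "\<not> (\<exists>H. infinite H \<and> homogeneous c H \<and> computes L H)" by blast
  moreover from this Jk have "L \<subseteq> Y" "limit_homogeneous d Y k L"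
    unfolding limit_homogeneous_def A_def by blast+
  ultimately show ?thesis by blast
qed

end
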